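(* Let $K$ be an algebraically closed field, $n\ge2$, and let $J_{A(\varepsilon)}\subset K(\varepsilon)[x,y,z]$ be the multiview ideal of the configuration $A(\varepsilon)=(A_1,\dots,A_n)$ with $$A_i=\begin{bmatrix}1&1&0&0\\1&0&1&0\\\varepsilon^{n-i}&0&0&1\end{bmatrix}.$$ Let $\mathcal{G}_n$, $L_n$, $N_n$ be as defined in the context. Then: (a) The multiview ideal $J_{A(\varepsilon)}$ is generated by the set $\mathcal{G}_n$. (b) The binomial ideal $L_n$ equals the special fiber of $J_{A(\varepsilon)}$ for $\varepsilon=0$. (c) The monomial ideal $N_n$ is the initial ideal of $L_n$ with respect to the lexicographic term order with $x\succ y\succ z$.
   Context: $K(\varepsilon)$ is the field of rational functions in a parameter $\varepsilon$. $K[x,y,z]$ and $K(\varepsilon)[x,y,z]$ are polynomial rings in the $3n$ unknowns $x_i,y_i,z_i$ ($1\le i\le n$). The multiview ideal $J_{A(\varepsilon)}$ is the prime ideal of all polynomials in $K(\varepsilon)[x,y,z]$ vanishing on the closure in $(\mathbb{P}^2)^n$ (coordinates $(x_i:y_i:z_i)$ on the $i$-th factor) of the image of the rational map $\mathbb{P}^3\dashrightarrow(\mathbb{P}^2)^n$, $\mathbf{x}\mapsto(A_1\mathbf{x},\dots,A_n\mathbf{x})$. $\mathcal{G}_n$ is the set consisting of the quadrics $x_iy_j-x_jy_i$ for $1\le i<j\le n$ and, for all $1\le i<j<k\le n$, the three cubics $$(\varepsilon^{n-k}-\varepsilon^{n-i})x_iz_jx_k+(\varepsilon^{n-j}-\varepsilon^{n-k})z_ix_jx_k+(\varepsilon^{n-i}-\varepsilon^{n-j})x_ix_jz_k,$$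 $$(\varepsilon^{n-k}-\varepsilon^{n-i})y_iz_jy_k+(\varepsilon^{n-j}-\varepsilon^{n-k})z_iy_jy_k+(\varepsilon^{n-i}-\varepsilon^{n-j})y_iy_jz_k,$$ $$(\varepsilon^{n-k}-\varepsilon^{n-i})y_iz_jx_k+(\varepsilon^{n-j}-\varepsilon^{n-k})z_iy_jx_k+(\varepsilon^{n-i}-\varepsilon^{n-j})y_ix_jz_k.$$ $L_n\subset K[x,y,z]$ is the ideal generated by $x_iy_j-x_jy_i$ for $1\le i<j\le n$ and by $x_iz_jx_k-z_ix_jx_k$, $y_iz_jy_k-z_iy_jy_k$, $y_iz_jx_k-z_iy_jx_k$ for $1\le i<j<k\le n$. $N_n\subset K[x,y,z]$ is the monomial ideal generated by $x_iy_j$ for $1\le i<j\le n$ and by $x_iz_jx_k$, $y_iz_jy_k$, $y_iz_jx_k$ for $1\le i<j<k\le n$. Special fiber: let $\mathrm{val}:K(\varepsilon)\to\mathbb{Z}\cup\{\infty\}$ be the order of vanishing at $\varepsilon=0$ (lowest exponent of the Laurent expansion), $R=\{c\in K(\varepsilon):\mathrm{val}(c)\ge0\}$ its valuation ring, with residue field $K$ via evaluation at $\varepsilon=0$. The special fiber of an ideal $I\subset K(\varepsilon)[x,y,z]$ is the image of $I\cap R[x,y,z]$ in $K[x,y,z]$ under $\varepsilon\mapsto0$. The lexicographic order is $x_1\succ\cdots\succ x_n\succ y_1\succ\cdots\succ y_n\succ z_1\succ\cdots\succ z_n$. *)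

theory Defs
  imports
    "HOL-Library.Poly_Mapping"
    "HOL-Library.Extended"
    "HOL-Computational_Algebra.Polynomial"
    "HOL-Computational_Algebra.Fraction_Field"
    "HOL-Algebra.Ideal"
    "HOL-Analysis.Cartesian_Space"
begin

datatype unknown = X nat | Y nat | Z nat

text \<open>
  The linear order below lists the unknowns from the most to the least significant one:
  X 1 < X 2 < ... < Y 1 < Y 2 < ... < Z 1 < Z 2 < ...
\<close>

fun block :: "unknown \<Rightarrow> nat" where
  "block (X i) = 0" | "block (Y i) = 1" | "block (Z i) = 2"

fun index :: "unknown \<Rightarrow> nat" where
  "index (X i) = i" | "index (Y i) = i" | "index (Z i) = i"

lemma unknown_eqI: "block v = block w \<Longrightarrow> index v = index w \<Longrightarrow> v = w"
  by (cases v; cases w) auto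

instantiation unknown :: linorder
begin

definition less_eq_unknown :: "unknown \<Rightarrow> unknown \<Rightarrow> bool" where
  "v \<le> w \<longleftrightarrow> block v < block w \<or> block v = block w \<and> index v \<le> index w"

definition less_unknown :: "unknown \<Rightarrow> unknown \<Rightarrow> bool" where
  "v < w \<longleftrightarrow> block v < block w \<or> block v = block w \<and> index v < index w"

instance
  by standard (auto simp: less_eq_unknown_def less_unknown_def intro: unknown_eqI)

end

type_synonym monomial = "unknown \<Rightarrow>\<^sub>0 nat"
type_synonym 'a mpoly = "monomial \<Rightarrow>\<^sub>0 'a"

definition indet :: "unknown \<Rightarrow> 'a::comm_ring_1 mpoly" where
  "indet v = Poly_Mapping.single (Poly_Mapping.single v 1) 1"

definition const :: "'a \<Rightarrow> 'a::comm_ring_1 mpoly" where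
  "const c = Poly_Mapping.single 0 c"

definition unknowns :: "nat \<Rightarrow> unknown set" where
  "unknowns n = (\<Union>i\<in>{1..n}. {X i, Y i, Z i})"

definition mpolys :: "nat \<Rightarrow> 'a::comm_ring_1 mpoly set" where
  "mpolys n = {f. \<forall>m\<in>Poly_Mapping.keys f. Poly_Mapping.keys m \<subseteq> unknowns n}"

definition mpoly_ring :: "nat \<Rightarrow> 'a::comm_ring_1 mpoly ring" where
  "mpoly_ring n = \<lparr>carrier = mpolys n, mult = (*), one = 1, zero = 0, add = (+)\<rparr>"

definition eval_at :: "(unknown \<Rightarrow> 'a) \<Rightarrow> 'a::comm_ring_1 mpoly \<Rightarrow> 'a" where
  "eval_at a f = (\<Sum>m\<in>Poly_Mapping.keys f.
     Poly_Mapping.lookup f m * (\<Prod>v\<in>Poly_Mapping.keys m. a v ^ Poly_Mapping.lookup m v))"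

lemma mpoly_ring_cring: "cring (mpoly_ring n :: 'a::comm_ring_1 mpoly ring)"
proof -
  have add: "f + g \<in> mpolys n" if "f \<in> mpolys n" "g \<in> mpolys n" for f g :: "'a mpoly"
    using that Poly_Mapping.keys_add[of f g] by (fastforce simp: mpolys_def)
  have mult: "f * g \<in> mpolys n" if "f \<in> mpolys n" "g \<in> mpolys n" for f g :: "'a mpoly"
  proof -
    have "Poly_Mapping.keys m \<subseteq> unknowns n" if m: "m \<in> Poly_Mapping.keys (f * g)" for m
    proof -
      obtain a b where "m = a + b" "a \<in> Poly_Mapping.keys f" "b \<in> Poly_Mapping.keys g"
        using m Poly_Mapping.keys_mult[of f g] by blast
      then show ?thesis
        using \<open>f \<in> mpolys n\<close> \<open>g \<in> mpolys n\<close> Poly_Mapping.keys_add[of a b]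
        unfolding mpolys_def by blast
    qed
    then show ?thesis by (simp add: mpolys_def)
  qed
  have neg: "- f \<in> mpolys n" if "f \<in> mpolys n" for f :: "'a mpoly"
    using that by (simp add: mpolys_def)
  have "\<exists>g\<in>mpolys n. g + f = 0" if "f \<in> mpolys n" for f :: "'a mpoly"
    using neg[OF that] by (intro bexI[of _ "- f"]) auto
  moreover have "0 \<in> mpolys n" "1 \<in> mpolys n"
    by (auto simp: mpolys_def)
  ultimately show ?thesis
    by unfold_locales
      (auto simp: mpoly_ring_def add mult algebra_simps Units_def)
qed

text \<open>
  Monomials are compared by the order that the library provides on finitely supported
  functions.  It compares exponents at the least unknown at which they differ, so that it is
  the lexicographic term order with X 1 as the largest unknown.
\<close>

lemma monomial_less_iff:
  "(s :: monomial) < t \<longleftrightarrow>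
     (\<exists>v. Poly_Mapping.lookup s v < Poly_Mapping.lookup t v \<and>
          (\<forall>w<v. Poly_Mapping.lookup s w = Poly_Mapping.lookup t w))"
  by transfer (simp add: less_fun_def)

definition lead_monom :: "'a::comm_ring_1 mpoly \<Rightarrow> monomial" where
  "lead_monom f = Max (Poly_Mapping.keys f)"

definition initial_ideal :: "nat \<Rightarrow> 'a::comm_ring_1 mpoly set \<Rightarrow> 'a mpoly set" where
  "initial_ideal n I =
     genideal (mpoly_ring n) {Poly_Mapping.single (lead_monom f) 1 | f. f \<in> I \<and> f \<noteq> 0}"

text \<open>
  A point of the n-fold product of the projective plane is represented by any family p of
  nonzero vectors of homogeneous coordinates p 1, ..., p n.  The sets of points below are
  closed under rescaling each p i.  All points are rational over the base field; over an infinite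
  field the rational points of a projective space are dense, so that the multiview ideal is the
  same as the one obtained from points over an algebraic closure.
\<close>

definition rep_points :: "nat \<Rightarrow> (nat \<Rightarrow> 'f::field ^ 3) set" where
  "rep_points n = {p. \<forall>i\<in>{1..n}. p i \<noteq> 0}"

fun coords :: "(nat \<Rightarrow> 'f::field ^ 3) \<Rightarrow> unknown \<Rightarrow> 'f" where
  "coords p (X i) = p i $ 1" | "coords p (Y i) = p i $ 2" | "coords p (Z i) = p i $ 3"

definition multihomogeneous :: "nat \<Rightarrow> 'f::field mpoly \<Rightarrow> bool" where
  "multihomogeneous n f \<longleftrightarrow> (\<exists>d. \<forall>m\<in>Poly_Mapping.keys f. \<forall>i\<in>{1..n}.
     Poly_Mapping.lookup m (X i) + Poly_Mapping.lookup m (Y i) + Poly_Mapping.lookup m (Z i) = d i)"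

definition zariski_closure :: "nat \<Rightarrow> (nat \<Rightarrow> 'f::field ^ 3) set \<Rightarrow> (nat \<Rightarrow> 'f ^ 3) set" where
  "zariski_closure n S = {p \<in> rep_points n.
     \<forall>f\<in>mpolys n. multihomogeneous n f \<longrightarrow> (\<forall>q\<in>S. eval_at (coords q) f = 0) \<longrightarrow> eval_at (coords p) f = 0}"

definition camera_image :: "nat \<Rightarrow> (nat \<Rightarrow> 'f::field ^ 4 ^ 3) \<Rightarrow> (nat \<Rightarrow> 'f ^ 3) set" where
  "camera_image n A = {p. \<exists>u. u \<noteq> 0 \<and>
     (\<forall>i\<in>{1..n}. A i *v u \<noteq> 0 \<and> (\<exists>c. c \<noteq> 0 \<and> p i = c *s (A i *v u)))}"

text \<open>
  Since all representatives of a point of the closure are taken into account, a polynomial that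
  is not multihomogeneous has to vanish for every choice of homogeneous coordinates.
\<close>

definition multiview_ideal :: "nat \<Rightarrow> (nat \<Rightarrow> 'f::field ^ 4 ^ 3) \<Rightarrow> 'f mpoly set" where
  "multiview_ideal n A =
     {f \<in> mpolys n. \<forall>p\<in>zariski_closure n (camera_image n A). eval_at (coords p) f = 0}"

definition eps :: "'k::field poly fract" where
  "eps = Fract [:0, 1:] 1"

definition val :: "'k::field poly fract \<Rightarrow> int extended" where
  "val c = (if c = 0 then Pinf else Fin (THE k. \<exists>p q. p \<noteq> 0 \<and> q \<noteq> 0 \<and> c = Fract p q \<and>
     k = int (Polynomial.order 0 p) - int (Polynomial.order 0 q)))"

lemma val_Fract:
  assumes "p \<noteq> 0" "q \<noteq> 0"
  shows "val (Fract p q) = Fin (int (Polynomial.order 0 p) - int (Polynomial.order 0 q))"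
proof -
  have "int (Polynomial.order 0 p') - int (Polynomial.order 0 q') =
        int (Polynomial.order 0 p) - int (Polynomial.order 0 q)"
    if "p' \<noteq> 0" "q' \<noteq> 0" "Fract p q = Fract p' q'" for p' q'
  proof -
    have "p * q' = p' * q" using that assms by (simp add: eq_fract)
    then have "Polynomial.order 0 p + Polynomial.order 0 q' =
               Polynomial.order 0 p' + Polynomial.order 0 q"
      using that assms by (metis mult_eq_0_iff order_mult)
    then show ?thesis by linarith
  qed
  then have "(THE k. \<exists>p' q'. p' \<noteq> 0 \<and> q' \<noteq> 0 \<and> Fract p q = Fract p' q' \<and>
      k = int (Polynomial.order 0 p') - int (Polynomial.order 0 q')) =
      int (Polynomial.order 0 p) - int (Polynomial.order 0 q)"
    using assms by (intro the_equality) blast+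
  moreover have "Fract p q \<noteq> 0"
    using assms by (simp add: Zero_fract_def eq_fract)
  ultimately show ?thesis by (simp add: val_def)
qed

definition val_ring :: "'k::field poly fract set" where
  "val_ring = {c. 0 \<le> val c}"

text \<open>Evaluation at 0; it is only meaningful on the valuation ring.\<close>

definition residue :: "'k::field poly fract \<Rightarrow> 'k" where
  "residue c = (THE a. \<exists>p q. poly q 0 \<noteq> 0 \<and> c = Fract p q \<and> a = poly p 0 / poly q 0)"

lemma residue_Fract:
  assumes "poly q 0 \<noteq> 0"
  shows "residue (Fract p q) = poly p 0 / poly q 0"
  unfolding residue_def
proof (rule the_equality)
  show "\<exists>p' q'. poly q' 0 \<noteq> 0 \<and> Fract p q = Fract p' q' \<and> poly p 0 / poly q 0 = poly p' 0 / poly q' 0"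
    using assms by blast
next
  fix a assume "\<exists>p' q'. poly q' 0 \<noteq> 0 \<and> Fract p q = Fract p' q' \<and> a = poly p' 0 / poly q' 0"
  then obtain p' q' where *: "poly q' 0 \<noteq> 0" "Fract p q = Fract p' q'" "a = poly p' 0 / poly q' 0"
    by blast
  moreover have "q \<noteq> 0" "q' \<noteq> 0" using assms * by auto
  ultimately have "p * q' = p' * q" by (simp add: eq_fract)
  then have "poly p 0 * poly q' 0 = poly p' 0 * poly q 0" by (metis poly_mult)
  then show "a = poly p 0 / poly q 0" using assms * by (simp add: frac_eq_eq)
qed

definition special_fiber :: "'k::field poly fract mpoly set \<Rightarrow> 'k mpoly set" where
  "special_fiber I =
     Poly_Mapping.map residue ` {f \<in> I. \<forall>m. Poly_Mapping.lookup f m \<in> val_ring}"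

definition camera :: "nat \<Rightarrow> nat \<Rightarrow> 'k::field poly fract ^ 4 ^ 3" where
  "camera n i = vector [vector [1, 1, 0, 0],
                        vector [1, 0, 1, 0],
                        vector [eps ^ (n - i), 0, 0, 1]]"

definition cubic :: "nat \<Rightarrow> nat \<Rightarrow> nat \<Rightarrow> nat \<Rightarrow> (nat \<Rightarrow> unknown) \<Rightarrow> (nat \<Rightarrow> unknown)
    \<Rightarrow> 'k::field poly fract mpoly" where
  "cubic n i j k U V =
     const (eps ^ (n - k) - eps ^ (n - i)) * indet (U i) * indet (Z j) * indet (V k) +
     const (eps ^ (n - j) - eps ^ (n - k)) * indet (Z i) * indet (U j) * indet (V k) +
     const (eps ^ (n - i) - eps ^ (n - j)) * indet (U i) * indet (V j) * indet (Z k)"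

definition quadrics :: "nat \<Rightarrow> 'a::comm_ring_1 mpoly set" where
  "quadrics n = {indet (X i) * indet (Y j) - indet (X j) * indet (Y i) | i j.
     1 \<le> i \<and> i < j \<and> j \<le> n}"

definition G_set :: "nat \<Rightarrow> 'k::field poly fract mpoly set" where
  "G_set n = quadrics n \<union>
     (\<Union>(i, j, k)\<in>{(i, j, k). 1 \<le> i \<and> i < j \<and> j < k \<and> k \<le> n}.
        {cubic n i j k X X, cubic n i j k Y Y, cubic n i j k Y X})"

definition L_ideal :: "nat \<Rightarrow> 'k::field mpoly set" where
  "L_ideal n = genideal (mpoly_ring n) (quadrics n \<union>
     (\<Union>(i, j, k)\<in>{(i, j, k). 1 \<le> i \<and> i < j \<and> j < k \<and> k \<le> n}.
        {indet (X i) * indet (Z j) * indet (X k) - indet (Z i) * indet (X j) * indet (X k),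
         indet (Y i) * indet (Z j) * indet (Y k) - indet (Z i) * indet (Y j) * indet (Y k),
         indet (Y i) * indet (Z j) * indet (X k) - indet (Z i) * indet (Y j) * indet (X k)}))"

definition N_ideal :: "nat \<Rightarrow> 'k::field mpoly set" where
  "N_ideal n = genideal (mpoly_ring n)
     ({indet (X i) * indet (Y j) | i j. 1 \<le> i \<and> i < j \<and> j \<le> n} \<union>
      (\<Union>(i, j, k)\<in>{(i, j, k). 1 \<le> i \<and> i < j \<and> j < k \<and> k \<le> n}.
        {indet (X i) * indet (Z j) * indet (X k),
         indet (Y i) * indet (Z j) * indet (Y k),
         indet (Y i) * indet (Z j) * indet (X k)}))"

end

(*
  Put t_i = eps^(n-i). After a linear change of coordinates the cameras are
  (x : y : s : w) |-> (x : y : t_i s + w), so J is the set of polynomials vanishing at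
  x_i = l_i x, y_i = l_i y, z_i = l_i (t_i s + w).

  Call a monomial standard if it avoids the generators of N. Dividing a cubic of G by t_i - t_k gives
  u_i z_j v_k = A z_i u_j v_k + B u_i v_j z_k with A, B in the valuation ring, A = 1 and B = 0 at
  eps = 0. Hence every monomial m is, modulo G and over the valuation ring, a combination of standard
  monomials; those with a coefficient that survives at eps = 0 are lexicographically at most m.

  The standard monomials are linearly independent modulo J. By multihomogeneity only those with fixed
  degrees in x, in y and in each factor matter; for these the value is a product of linear forms
  t_i s + w, and the monomial whose xy-part starts leftmost, in factor p say, has the strictly smallest
  order of vanishing at t_p s + w = 0.

  So the normal form of an element of J is 0, which puts it in the ideal of G and, at eps = 0, in L,
  and a leading monomial of an element of L cannot be standard.
*)

theory Submission
  imports Defs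
begin

abbreviation "lookup \<equiv> Poly_Mapping.lookup"
abbreviation "keys \<equiv> Poly_Mapping.keys"
abbreviation "single \<equiv> Poly_Mapping.single"

subsection \<open>The valuation ring and reduction at eps = 0\<close>

lemma val_ring_Fract: "poly q 0 \<noteq> 0 \<Longrightarrow> Fract p q \<in> val_ring"
proof -
  assume q: "poly q 0 \<noteq> 0"
  then have "q \<noteq> 0" by auto
  show ?thesis
  proof (cases "p = 0")
    case True
    then have "Fract p q = 0" by (simp add: fract_collapse)
    then show ?thesis by (simp add: val_ring_def val_def zero_extended_def)
  next
    case False
    then show ?thesis using q \<open>q \<noteq> 0\<close>
      by (simp add: val_ring_def val_Fract order_0I zero_extended_def)
  qed
qed

text \<open>The power of eps dividing the denominator also divides the numerator and is cancelled,
  so the remaining denominator does not vanish at 0 and \<open>residue_Fract\<close>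
  applies.\<close>

lemma val_ring_cases:
  assumes "c \<in> val_ring"
  obtains p q where "poly q 0 \<noteq> 0" "c = Fract p q"
proof (cases "c = 0")
  case True
  then show thesis using that[of 1 0] by (simp add: Zero_fract_def)
next
  case False
  then obtain p q where c: "c = Fract p q" "p \<noteq> 0" "q \<noteq> 0"
    by (cases c rule: Fract_cases_nonzero) auto
  let ?k = "Polynomial.order 0 q"
  from assms have "?k \<le> Polynomial.order 0 p"
    by (simp add: val_ring_def c val_Fract zero_extended_def)
  then have "[:-0, 1:] ^ ?k dvd p"
    using dvd_trans[OF le_imp_power_dvd order_1] by blast
  then obtain p' where p': "p = [:-0, 1:] ^ ?k * p'" by (rule dvdE)
  obtain q' where q': "q = [:-0, 1:] ^ ?k * q'" "\<not> [:-0, 1:] dvd q'"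
    using order_decomp[OF c(3)] by blast
  have "q' \<noteq> 0" using q' c(3) by auto
  then have "c = Fract p' q'"
    unfolding c(1) using c(3) by (subst eq_fract) (simp_all, metis p' q'(1) mult.assoc mult.commute)
  moreover have "poly q' 0 \<noteq> 0"
    using q'(2) poly_eq_0_iff_dvd[of q' 0] by simp
  ultimately show thesis using that by blast
qed

lemma Fract_add_mult:
  assumes "poly q 0 \<noteq> 0" "poly q' 0 \<noteq> 0"
  shows "Fract p q + Fract p' q' = Fract (p * q' + p' * q) (q * q')"
    and "Fract p q * Fract p' q' = Fract (p * p') (q * q')"
  using assms by (auto intro!: add_fract)

lemma
  assumes "c \<in> val_ring" "d \<in> val_ring"
  shows val_ring_add: "c + d \<in> val_ring" and val_ring_mult: "c * d \<in> val_ring"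
    and residue_add: "residue (c + d) = residue c + residue d"
    and residue_mult: "residue (c * d) = residue c * residue d"
proof -
  obtain p q where c: "poly q 0 \<noteq> 0" "c = Fract p q" using assms(1) by (rule val_ring_cases)
  obtain p' q' where d: "poly q' 0 \<noteq> 0" "d = Fract p' q'" using assms(2) by (rule val_ring_cases)
  have eq: "c + d = Fract (p * q' + p' * q) (q * q')" "c * d = Fract (p * p') (q * q')"
    using Fract_add_mult c d by blast+
  have q: "poly (q * q') 0 \<noteq> 0" using c d by simp
  show "c + d \<in> val_ring" "c * d \<in> val_ring"
    unfolding eq using q by (rule val_ring_Fract)+
  show "residue (c + d) = residue c + residue d"
    unfolding eq(1) residue_Fract[OF q]
    unfolding c(2) d(2) residue_Fract[OF c(1)] residue_Fract[OF d(1)]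
    using c(1) d(1) by (simp add: field_simps)
  show "residue (c * d) = residue c * residue d"
    unfolding eq(2) residue_Fract[OF q]
    unfolding c(2) d(2) residue_Fract[OF c(1)] residue_Fract[OF d(1)] by simp
qed

text \<open>The embedding of K into K(eps). As a section of \<open>residue\<close> it lifts
  polynomials over K to integral ones.\<close>

definition scalar :: "'k::field \<Rightarrow> 'k poly fract" where
  "scalar c = Fract [:c:] 1"

lemma scalar_in_val_ring: "scalar c \<in> val_ring"
  unfolding scalar_def by (rule val_ring_Fract) simp

lemma residue_scalar: "residue (scalar c) = c"
  unfolding scalar_def by (subst residue_Fract) auto

lemma scalar_simps: "scalar 0 = 0" "scalar 1 = 1" "scalar (-1) = - 1"
  by (simp_all add: scalar_def Zero_fract_def One_fract_def one_pCons)

lemma val_ring_consts: "0 \<in> val_ring" "1 \<in> val_ring" "- 1 \<in> val_ring"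
  by (metis scalar_in_val_ring scalar_simps)+

lemma residue_consts: "residue 0 = 0" "residue 1 = 1" "residue (- 1) = - 1"
  by (metis residue_scalar scalar_simps)+

lemma val_ring_uminus: "c \<in> val_ring \<Longrightarrow> - c \<in> val_ring"
  using val_ring_mult[OF val_ring_consts(3), of c] by simp

lemma residue_uminus: "c \<in> val_ring \<Longrightarrow> residue (- c) = - residue c"
  using residue_mult[OF val_ring_consts(3), of c] by (simp add: residue_consts)

lemma val_ring_sum: "(\<And>i. i \<in> A \<Longrightarrow> f i \<in> val_ring) \<Longrightarrow> sum f A \<in> val_ring"
  by (induction A rule: infinite_finite_induct) (auto simp: val_ring_consts val_ring_add)

lemma residue_sum:
  "(\<And>i. i \<in> A \<Longrightarrow> f i \<in> val_ring) \<Longrightarrow> residue (sum f A) = (\<Sum>i\<in>A. residue (f i))"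
  by (induction A rule: infinite_finite_induct)
    (auto simp: residue_consts residue_add val_ring_sum)

section \<open>Powers of eps and their quotients\<close>

lemma eps_nonzero: "eps \<noteq> 0"
  by (simp add: eps_def Zero_fract_def eq_fract)

lemma eps_power: "eps ^ k = Fract (Polynomial.monom 1 k) 1"
  by (induction k) (simp_all add: eps_def One_fract_def monom_Suc)

lemma eps_power_inj: "(eps :: 'k::field poly fract) ^ a = eps ^ b \<longleftrightarrow> a = b"
proof
  assume "(eps :: 'k poly fract) ^ a = eps ^ b"
  then have "Polynomial.monom (1::'k) a = Polynomial.monom 1 b"
    by (simp add: eps_power eq_fract)
  then show "a = b" by (metis Polynomial.coeff_monom one_neq_zero)
qed simp

lemma infinite_fract_nonzero: "infinite {T :: 'k::field poly fract. T \<noteq> 0}"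
proof -
  have "inj (\<lambda>a. (eps :: 'k poly fract) ^ a)"
    by (auto intro!: injI simp: eps_power_inj)
  then have "infinite (range (\<lambda>a. (eps :: 'k poly fract) ^ a))"
    by (simp add: range_inj_infinite)
  moreover have "range (\<lambda>a. (eps :: 'k poly fract) ^ a) \<subseteq> {T. T \<noteq> 0}"
    by (auto simp: eps_nonzero)
  ultimately show ?thesis using infinite_super by blast
qed

text \<open>These are the coefficients A and B of the rewriting by a cubic. Cancelling
  \<open>t k\<close> leaves A = (eps^(k-j) - 1) / (eps^(k-i) - 1) and B = (eps^(k-i) - eps^(k-j)) /
  (eps^(k-i) - 1), where all exponents are positive.\<close>

lemma residue_eps_quotients:
  fixes n i j k :: nat
  assumes "i < j" "j < k" "k \<le> n"
  defines "t \<equiv> \<lambda>i. (eps :: 'k::field poly fract) ^ (n - i)"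
  shows "(t j - t k) / (t i - t k) \<in> val_ring" "residue ((t j - t k) / (t i - t k)) = 1"
    "(t i - t j) / (t i - t k) \<in> val_ring" "residue ((t i - t j) / (t i - t k)) = 0"
proof -
  define P where "P = Polynomial.monom (1::'k) (k - j) - 1"
  define Q where "Q = Polynomial.monom (1::'k) (k - i) - 1"
  define P' where "P' = Polynomial.monom (1::'k) (k - i) - Polynomial.monom 1 (k - j)"
  have at0: "poly P 0 = - 1" "poly Q 0 = - 1" "poly P' 0 = 0"
    using assms(1-3) by (auto simp: P_def Q_def P'_def poly_monom power_0_left)
  \<comment> \<open>With j < k, the bound k <= n gives n - j = (n - k) + (k - j) for the truncated
    subtraction; likewise for i.\<close>
  have t: "t j = t k * Fract (Polynomial.monom 1 (k - j)) 1"
    "t i = t k * Fract (Polynomial.monom 1 (k - i)) 1"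
    unfolding t_def eps_power[symmetric] power_add[symmetric] using assms(1-3) by simp_all
  have tk: "t k \<noteq> 0" by (simp add: t_def eps_nonzero)
  have "(t j - t k) / (t i - t k) = Fract P 1 / Fract Q 1"
    and "(t i - t j) / (t i - t k) = Fract P' 1 / Fract Q 1"
  proof -
    have "t j - t k = t k * Fract P 1" "t i - t k = t k * Fract Q 1" "t i - t j = t k * Fract P' 1"
    proof -
      have diff: "Fract (p - q) 1 = Fract p 1 - Fract q 1" for p q :: "'k poly" by simp
      have one: "Fract (1 :: 'k poly) 1 = 1" by (simp add: One_fract_def)
      show "t j - t k = t k * Fract P 1" "t i - t k = t k * Fract Q 1" "t i - t j = t k * Fract P' 1"
        unfolding t P_def Q_def P'_def diff one by (simp_all only: algebra_simps mult_1_left)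
    qed
    then show "(t j - t k) / (t i - t k) = Fract P 1 / Fract Q 1"
      "(t i - t j) / (t i - t k) = Fract P' 1 / Fract Q 1"
      using tk by simp_all
  qed
  then show "(t j - t k) / (t i - t k) \<in> val_ring" "residue ((t j - t k) / (t i - t k)) = 1"
    "(t i - t j) / (t i - t k) \<in> val_ring" "residue ((t i - t j) / (t i - t k)) = 0"
    using at0 by (simp_all add: val_ring_Fract residue_Fract)
qed

section \<open>Polynomials over the valuation ring and their coefficientwise reduction\<close>

definition integral_polys :: "'k::field poly fract mpoly set" where
  "integral_polys = {f. \<forall>m. lookup f m \<in> val_ring}"

abbreviation "reduce \<equiv> Poly_Mapping.map residue"

text \<open>\<open>Poly_Mapping.map\<close> applies the function at nonzero coefficients only; the
  equation holds at every monomial because \<open>residue\<close> sends 0 to 0.\<close>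

lemma lookup_reduce: "lookup (reduce f) m = residue (lookup f m)"
  by (simp add: Poly_Mapping.map.rep_eq "when_def" residue_consts)

lemma sum_singles: "finite A \<Longrightarrow> keys f \<subseteq> A \<Longrightarrow> (\<Sum>m\<in>A. single m (lookup f m)) = f"
  by (rule poly_mapping_eqI)
    (auto simp: lookup_sum lookup_single "when_def" in_keys_iff sum.delta)

text \<open>Reduces multiplicativity of reduction and of evaluation to products of two
  terms.\<close>

lemma mult_eq_sum_singles:
  fixes f g :: "'a::comm_ring_1 mpoly"
  shows "f * g = (\<Sum>m\<in>keys f. \<Sum>m'\<in>keys g. single (m + m') (lookup f m * lookup g m'))"
proof -
  have "f * g = (\<Sum>m\<in>keys f. single m (lookup f m)) * (\<Sum>m'\<in>keys g. single m' (lookup g m'))"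
    by (simp add: sum_singles)
  then show ?thesis by (simp add: sum_product mult_single)
qed

lemma integral_polys_add: "f \<in> integral_polys \<Longrightarrow> g \<in> integral_polys \<Longrightarrow> f + g \<in> integral_polys"
  by (simp add: integral_polys_def lookup_add val_ring_add)

lemma integral_polys_uminus: "f \<in> integral_polys \<Longrightarrow> - f \<in> integral_polys"
  by (simp add: integral_polys_def val_ring_uminus)

lemma integral_polys_sum: "(\<And>i. i \<in> A \<Longrightarrow> f i \<in> integral_polys) \<Longrightarrow> sum f A \<in> integral_polys"
  by (simp add: integral_polys_def lookup_sum val_ring_sum)

lemma integral_polys_single: "c \<in> val_ring \<Longrightarrow> single m c \<in> integral_polys"
  by (simp add: integral_polys_def lookup_single "when_def" val_ring_consts)

lemma integral_polys_mult:
  "f \<in> integral_polys \<Longrightarrow> g \<in> integral_polys \<Longrightarrow> f * g \<in> integral_polys"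
  unfolding mult_eq_sum_singles
  by (intro integral_polys_sum integral_polys_single val_ring_mult)
    (simp_all add: integral_polys_def)

lemma reduce_add:
  "f \<in> integral_polys \<Longrightarrow> g \<in> integral_polys \<Longrightarrow> reduce (f + g) = reduce f + reduce g"
  by (rule poly_mapping_eqI) (simp add: lookup_reduce lookup_add residue_add integral_polys_def)

lemma reduce_uminus: "f \<in> integral_polys \<Longrightarrow> reduce (- f) = - reduce f"
  by (rule poly_mapping_eqI) (simp add: lookup_reduce residue_uminus integral_polys_def)

lemma reduce_sum:
  "(\<And>i. i \<in> A \<Longrightarrow> f i \<in> integral_polys) \<Longrightarrow> reduce (sum f A) = (\<Sum>i\<in>A. reduce (f i))"
  by (rule poly_mapping_eqI) (simp add: lookup_reduce lookup_sum residue_sum integral_polys_def)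

lemma reduce_single: "reduce (single m c) = single m (residue c)"
  by (rule poly_mapping_eqI) (simp add: lookup_reduce lookup_single "when_def" residue_consts)

lemma reduce_mult:
  assumes "f \<in> integral_polys" "g \<in> integral_polys"
  shows "reduce (f * g) = reduce f * reduce g"
proof -
  have 1: "single (m + m') (lookup f m * lookup g m') \<in> integral_polys" for m m'
    using assms by (intro integral_polys_single val_ring_mult) (simp_all add: integral_polys_def)
  \<comment> \<open>Coefficients may vanish at eps = 0, so the support can shrink; sums over
    \<open>keys f\<close> still represent \<open>reduce f\<close>.\<close>
  have sub: "keys (reduce h) \<subseteq> keys h" for h :: "'a poly fract mpoly"
    by (auto simp: in_keys_iff lookup_reduce residue_consts)
  have "reduce (f * g) =
      (\<Sum>m\<in>keys f. \<Sum>m'\<in>keys g. single (m + m') (residue (lookup f m) * residue (lookup g m')))"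
  proof -
    have "reduce (f * g) =
        (\<Sum>m\<in>keys f. reduce (\<Sum>m'\<in>keys g. single (m + m') (lookup f m * lookup g m')))"
      unfolding mult_eq_sum_singles by (intro reduce_sum integral_polys_sum 1)
    also have "\<dots> = (\<Sum>m\<in>keys f. \<Sum>m'\<in>keys g.
        reduce (single (m + m') (lookup f m * lookup g m')))"
      by (intro sum.cong refl reduce_sum 1)
    finally show ?thesis
      using assms by (simp add: reduce_single residue_mult integral_polys_def)
  qed
  also have "\<dots> = (\<Sum>m\<in>keys f. single m (lookup (reduce f) m)) *
      (\<Sum>m'\<in>keys g. single m' (lookup (reduce g) m'))"
    by (simp add: sum_product mult_single lookup_reduce)
  also have "\<dots> = reduce f * reduce g" by (simp add: sum_singles sub)
  finally show ?thesis .
qed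

section \<open>The polynomial ring in the 3n unknowns and its ideals\<close>

lemma mpolys_zero: "0 \<in> mpolys n"
  by (simp add: mpolys_def)

lemma mpolys_add: "f \<in> mpolys n \<Longrightarrow> g \<in> mpolys n \<Longrightarrow> f + g \<in> mpolys n"
  using cring.cring_simprules(1)[OF mpoly_ring_cring, of f n g] by (simp add: mpoly_ring_def)

lemma mpolys_mult: "f \<in> mpolys n \<Longrightarrow> g \<in> mpolys n \<Longrightarrow> f * g \<in> mpolys n"
  using cring.cring_simprules(5)[OF mpoly_ring_cring, of f n g] by (simp add: mpoly_ring_def)

lemma mpolys_uminus: "f \<in> mpolys n \<Longrightarrow> - f \<in> mpolys n"
  by (simp add: mpolys_def)

lemma mpolys_diff: "f \<in> mpolys n \<Longrightarrow> g \<in> mpolys n \<Longrightarrow> f - g \<in> mpolys n"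
  using mpolys_add[of f n "- g"] by (simp add: mpolys_uminus)

lemma mpolys_single: "keys m \<subseteq> unknowns n \<Longrightarrow> single m c \<in> mpolys n"
  by (simp add: mpolys_def)

lemma mpolys_indet: "v \<in> unknowns n \<Longrightarrow> indet v \<in> mpolys n"
  unfolding indet_def by (rule mpolys_single) simp

lemma mpolys_const: "const c \<in> mpolys n"
  unfolding const_def by (rule mpolys_single) simp

lemma mpolys_reduce: "f \<in> mpolys n \<Longrightarrow> reduce f \<in> mpolys n"
  by (auto simp: mpolys_def in_keys_iff lookup_reduce residue_consts)

text \<open>Replaces the locale by closure conditions in the ambient type. Negatives do not appear
  on the right because they are multiples by -1.\<close>

lemma ideal_mpoly_ring_iff:
  fixes I :: "'a::comm_ring_1 mpoly set"
  shows "ideal I (mpoly_ring n) \<longleftrightarrow> I \<subseteq> mpolys n \<and> 0 \<in> I \<and>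
    (\<forall>f\<in>I. \<forall>g\<in>I. f + g \<in> I) \<and> (\<forall>f\<in>I. \<forall>g\<in>mpolys n. g * f \<in> I)"
proof
  assume "ideal I (mpoly_ring n)"
  then interpret ideal I "mpoly_ring n" .
  show "I \<subseteq> mpolys n \<and> 0 \<in> I \<and> (\<forall>f\<in>I. \<forall>g\<in>I. f + g \<in> I) \<and> (\<forall>f\<in>I. \<forall>g\<in>mpolys n. g * f \<in> I)"
    using a_subset additive_subgroup.zero_closed[OF is_additive_subgroup]
      additive_subgroup.a_closed[OF is_additive_subgroup] I_l_closed
    by (auto simp: mpoly_ring_def)
next
  assume I: "I \<subseteq> mpolys n \<and> 0 \<in> I \<and>
    (\<forall>f\<in>I. \<forall>g\<in>I. f + g \<in> I) \<and> (\<forall>f\<in>I. \<forall>g\<in>mpolys n. g * f \<in> I)"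
  interpret R: cring "mpoly_ring n :: 'a mpoly ring" by (rule mpoly_ring_cring)
  have m1: "- 1 \<in> mpolys n" by (rule mpolys_uminus) (simp add: mpolys_def)
  have neg: "- f \<in> I" if "f \<in> I" for f
    using I that m1 by (metis mult_minus1)
  show "ideal I (mpoly_ring n)"
  proof (rule idealI)
    show "subgroup I (add_monoid (mpoly_ring n))"
    proof (rule R.add.subgroupI)
      fix f assume f: "f \<in> I"
      then have "f \<in> carrier (mpoly_ring n)" "- f \<in> carrier (mpoly_ring n)"
        using I neg by (auto simp: mpoly_ring_def)
      then have "\<ominus>\<^bsub>mpoly_ring n\<^esub> f = - f"
        by (intro R.minus_equality) (auto simp: mpoly_ring_def)
      then show "\<ominus>\<^bsub>mpoly_ring n\<^esub> f \<in> I" using neg f by simp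
    qed (use I in \<open>auto simp: mpoly_ring_def\<close>)
  qed (use I R.ring_axioms in \<open>auto simp: mpoly_ring_def mult.commute\<close>)
qed

lemma genideal_superset: "S \<subseteq> genideal R S"
  by (auto simp: genideal_def)

lemma genideal_ideal: "S \<subseteq> mpolys n \<Longrightarrow> ideal (genideal (mpoly_ring n) S) (mpoly_ring n)"
  using ring.genideal_ideal[OF cring.axioms(1)[OF mpoly_ring_cring]]
  by (simp add: mpoly_ring_def)

lemma genideal_least: "ideal I R \<Longrightarrow> S \<subseteq> I \<Longrightarrow> genideal R S \<subseteq> I"
  by (auto simp: genideal_def)

lemma ideal_sum:
  assumes "ideal I (mpoly_ring n)" "\<And>i. i \<in> A \<Longrightarrow> f i \<in> I"
  shows "sum f A \<in> I"
  using assms(2) by (induction A rule: infinite_finite_induct)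
    (use assms(1) in \<open>auto simp: ideal_mpoly_ring_iff\<close>)

subsection \<open>Independence of the standard monomials\<close>

definition mono_eval :: "(unknown \<Rightarrow> 'a::comm_ring_1) \<Rightarrow> monomial \<Rightarrow> 'a" where
  "mono_eval a m = (\<Prod>v\<in>keys m. a v ^ lookup m v)"

lemma mono_eval_superset:
  "finite V \<Longrightarrow> keys m \<subseteq> V \<Longrightarrow> mono_eval a m = (\<Prod>v\<in>V. a v ^ lookup m v)"
  unfolding mono_eval_def by (rule prod.mono_neutral_left) (auto simp: in_keys_iff)

lemma mono_eval_add: "mono_eval a (m + m') = mono_eval a m * mono_eval a m'"
proof -
  let ?V = "keys m \<union> keys m'"
  have "keys (m + m') \<subseteq> ?V" by (rule Poly_Mapping.keys_add)
  then show ?thesis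
    using mono_eval_superset[of ?V "m + m'" a] mono_eval_superset[of ?V m a]
      mono_eval_superset[of ?V m' a]
    by (simp add: lookup_add power_add prod.distrib)
qed

lemma mono_eval_single: "mono_eval a (single v k) = a v ^ k"
  by (simp add: mono_eval_def)

lemma eval_at_superset:
  "finite A \<Longrightarrow> keys f \<subseteq> A \<Longrightarrow> eval_at a f = (\<Sum>m\<in>A. lookup f m * mono_eval a m)"
  unfolding eval_at_def mono_eval_def by (rule sum.mono_neutral_left) (auto simp: in_keys_iff)

lemma eval_at_add: "eval_at a (f + g) = eval_at a f + eval_at a g"
proof -
  let ?A = "keys f \<union> keys g"
  have "keys (f + g) \<subseteq> ?A" by (rule Poly_Mapping.keys_add)
  then show ?thesis
    using eval_at_superset[of ?A "f + g" a] eval_at_superset[of ?A f a]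
      eval_at_superset[of ?A g a]
    by (simp add: lookup_add distrib_right sum.distrib)
qed

lemma eval_at_zero: "eval_at a 0 = 0"
  by (simp add: eval_at_def)

lemma eval_at_sum: "eval_at a (sum f A) = (\<Sum>i\<in>A. eval_at a (f i))"
  by (induction A rule: infinite_finite_induct) (simp_all add: eval_at_zero eval_at_add)

lemma eval_at_single: "eval_at a (single m c) = c * mono_eval a m"
  using eval_at_superset[of "{m}" "single m c" a] by simp

lemma eval_at_mult: "eval_at a (f * g) = eval_at a f * eval_at a g"
  unfolding mult_eq_sum_singles
  by (simp add: eval_at_sum eval_at_single mono_eval_add sum_product
      eval_at_superset[of "keys f" f] eval_at_superset[of "keys g" g] mult_ac)

lemma eval_at_uminus: "eval_at a (- f) = - eval_at a f"
  using eval_at_add[of a f "- f"] by (simp add: eval_at_zero eq_neg_iff_add_eq_0 add.commute)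

lemma eval_at_diff: "eval_at a (f - g) = eval_at a f - eval_at a g"
  using eval_at_add[of a f "- g"] by (simp add: eval_at_uminus)

lemma eval_at_indet: "eval_at a (indet v) = a v"
  by (simp add: indet_def eval_at_single mono_eval_single)

lemma eval_at_const: "eval_at a (const c) = c"
  by (simp add: const_def eval_at_single mono_eval_def)

lemmas eval_at_simps =
  eval_at_add eval_at_diff eval_at_mult eval_at_indet eval_at_const


text \<open>
  After a linear change of coordinates on the source, camera i is the map
  (x : y : s : w) to (x : y : eps^(n-i) s + w); l i rescales the i-th image point.
\<close>

fun view :: "nat \<Rightarrow> (nat \<Rightarrow> 'k poly fract) \<Rightarrow> 'k poly fract \<Rightarrow> 'k poly fract \<Rightarrow>
    'k poly fract \<Rightarrow> 'k poly fract \<Rightarrow> unknown \<Rightarrow> 'k::field poly fract" where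
  "view n l x y s w (X i) = l i * x"
| "view n l x y s w (Y i) = l i * y"
| "view n l x y s w (Z i) = l i * (eps ^ (n - i) * s + w)"

text \<open>With x and all \<open>l i\<close> nonzero every image vector is nonzero; the conditions
  on x, y and l are also stable under scaling by nonzero T.\<close>

definition views :: "nat \<Rightarrow> (unknown \<Rightarrow> 'k::field poly fract) set" where
  "views n = {view n l x y s w | l x y s w. (\<forall>i. l i \<noteq> 0) \<and> x \<noteq> 0 \<and> y \<noteq> 0}"

section \<open>Gradings and homogeneous components\<close>

definition weight :: "(unknown \<Rightarrow> nat) \<Rightarrow> monomial \<Rightarrow> nat" where
  "weight g m = (\<Sum>v\<in>keys m. g v * lookup m v)"

text \<open>Degree in the x, degree in the y, and degree in each factor. Each belongs to a parameter
  of \<open>view\<close> that can be scaled on its own: x, y or \<open>l i\<close>.\<close>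

definition gradings :: "nat \<Rightarrow> (unknown \<Rightarrow> nat) set" where
  "gradings n = insert (\<lambda>v. of_bool (block v = 0)) (insert (\<lambda>v. of_bool (block v = 1))
     ((\<lambda>i v. of_bool (index v = i)) ` {1..n}))"

lemma views_rescale:
  assumes "g \<in> gradings n" "a \<in> views n" "T \<noteq> 0"
  shows "(\<lambda>v. T ^ g v * a v) \<in> views n"
proof -
  obtain l x y s w where a: "a = view n l x y s w" "\<forall>i. l i \<noteq> 0" "x \<noteq> 0" "y \<noteq> 0"
    using assms(2) by (auto simp: views_def)
  consider "g = (\<lambda>v. of_bool (block v = 0))" | "g = (\<lambda>v. of_bool (block v = 1))"
    | i where "g = (\<lambda>v. of_bool (index v = i))"
    using assms(1) by (auto simp: gradings_def)
  then show ?thesis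
  proof cases
    case 1
    have "(\<lambda>v. T ^ g v * a v) = view n l (T * x) y s w"
      unfolding a(1) 1 by (rule ext, case_tac v) auto
    then show ?thesis unfolding views_def using a assms(3) by fastforce
  next
    case 2
    have "(\<lambda>v. T ^ g v * a v) = view n l x (T * y) s w"
      unfolding a(1) 2 by (rule ext, case_tac v) auto
    then show ?thesis unfolding views_def using a assms(3) by fastforce
  next
    case (3 i)
    have "(\<lambda>v. T ^ g v * a v) = view n (l(i := T * l i)) x y s w"
      unfolding a(1) 3 by (rule ext, case_tac v) auto
    moreover have "\<forall>j. (l(i := T * l i)) j \<noteq> 0" using a assms(3) by simp
    ultimately show ?thesis unfolding views_def using a(3,4) by blast
  qed
qed

lemma mono_eval_rescale: "mono_eval (\<lambda>v. T ^ g v * a v) m = T ^ weight g m * mono_eval a m"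
  by (simp add: mono_eval_def weight_def power_mult_distrib prod.distrib power_sum
      flip: power_mult)

text \<open>A nonzero polynomial has finitely many roots, but the powers of eps give infinitely many
  nonzero T.\<close>

lemma poly_zero_if_nonzero_roots:
  fixes Q :: "'k::field poly fract poly"
  assumes "\<And>T. T \<noteq> 0 \<Longrightarrow> poly Q T = 0"
  shows "Q = 0"
  using poly_roots_finite[of Q] infinite_fract_nonzero[where 'k = 'k] assms
  by (metis (mono_tags, lifting) finite_subset mem_Collect_eq subsetI)

text \<open>Along the orbit of a under scaling by T, the value of the polynomial is a polynomial in
  T whose coefficient at T^d is the component of weight d evaluated at a. It vanishes for all
  nonzero T, hence identically.\<close>

lemma graded_component_vanishes:
  fixes P :: "(unknown \<Rightarrow> 'k::field poly fract) set"
  assumes "finite A" "\<And>a T. a \<in> P \<Longrightarrow> T \<noteq> 0 \<Longrightarrow> (\<lambda>v. T ^ g v * a v) \<in> P"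
    and "\<And>a. a \<in> P \<Longrightarrow> (\<Sum>m\<in>A. c m * mono_eval a m) = 0" and "a \<in> P"
  shows "(\<Sum>m\<in>{m\<in>A. weight g m = d}. c m * mono_eval a m) = 0"
proof -
  define Q where "Q = (\<Sum>m\<in>A. Polynomial.monom (c m * mono_eval a m) (weight g m))"
  have "poly Q T = 0" if "T \<noteq> 0" for T
  proof -
    have "poly Q T = (\<Sum>m\<in>A. c m * mono_eval (\<lambda>v. T ^ g v * a v) m)"
      unfolding mono_eval_rescale by (simp add: Q_def poly_sum poly_monom mult_ac)
    then show ?thesis using assms(2-4) that by simp
  qed
  then have "Q = 0" by (rule poly_zero_if_nonzero_roots)
  then have "Polynomial.coeff Q d = 0" by simp
  moreover have "Polynomial.coeff Q d = (\<Sum>m\<in>A. if weight g m = d then c m * mono_eval a m else 0)"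
    by (simp add: Q_def Polynomial.coeff_sum)
  ultimately show ?thesis
    unfolding sum.inter_filter[OF assms(1)] by simp
qed

text \<open>One grading is split off at a time; the component obtained again vanishes on all of
  \<open>views\<close>, so the next grading can be treated in the same way.\<close>

lemma graded_components_vanish:
  assumes "finite G" "G \<subseteq> gradings n" "finite A"
    and "\<And>a. a \<in> views n \<Longrightarrow> (\<Sum>m\<in>A. c m * mono_eval a m) = 0" and "a \<in> views n"
  shows "(\<Sum>m\<in>{m\<in>A. \<forall>g\<in>G. weight g m = d g}. c m * mono_eval a m) = 0"
  using assms(1,2,5)
proof (induction G arbitrary: a rule: finite_induct)
  case empty
  then show ?case using assms(4) by simp
next
  case (insert g G)
  have "(\<Sum>m\<in>{m \<in> {m\<in>A. \<forall>g\<in>G. weight g m = d g}. weight g m = d g}. c m * mono_eval a m) = 0"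
    by (rule graded_component_vanishes[where P = "views n"])
      (use insert assms(3) views_rescale in auto)
  moreover have "{m \<in> {m\<in>A. \<forall>g\<in>G. weight g m = d g}. weight g m = d g} =
      {m\<in>A. \<forall>g\<in>insert g G. weight g m = d g}" by auto
  ultimately show ?case by simp
qed

section \<open>Combinatorics of standard monomials\<close>

definition xy :: "monomial \<Rightarrow> nat \<Rightarrow> nat" where
  "xy m i = lookup m (X i) + lookup m (Y i)"

text \<open>No generator of N divides m. Using \<open>xy\<close> merges the three cubic families
  into one condition: the combination x_i z_j y_k, which is not a generator, is already a multiple
  of x_i y_k. Indices need no bounds, since exponents outside 1..n are zero.\<close>

definition standard :: "nat \<Rightarrow> monomial \<Rightarrow> bool" where
  "standard n m \<longleftrightarrow> keys m \<subseteq> unknowns n \<and>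
     (\<forall>i j. i < j \<longrightarrow> lookup m (X i) = 0 \<or> lookup m (Y j) = 0) \<and>
     (\<forall>i j k. i < j \<longrightarrow> j < k \<longrightarrow> xy m i = 0 \<or> lookup m (Z j) = 0 \<or> xy m k = 0)"

lemma standardD:
  assumes "standard n m"
  shows "keys m \<subseteq> unknowns n" "i < j \<Longrightarrow> lookup m (X i) = 0 \<or> lookup m (Y j) = 0"
    "i < j \<Longrightarrow> j < k \<Longrightarrow> xy m i = 0 \<or> lookup m (Z j) = 0 \<or> xy m k = 0"
  using assms unfolding standard_def by auto

lemma lookup_outside:
  "keys m \<subseteq> unknowns n \<Longrightarrow> index v \<notin> {1..n} \<Longrightarrow> lookup m v = 0"
  by (cases v) (auto simp: unknowns_def in_keys_iff)

lemma weight_unknowns: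
  assumes "keys m \<subseteq> unknowns n"
  shows "weight g m = (\<Sum>i\<in>{1..n}. g (X i) * lookup m (X i) + g (Y i) * lookup m (Y i)
    + g (Z i) * lookup m (Z i))"
proof -
  have "weight g m = (\<Sum>v\<in>unknowns n. g v * lookup m v)"
    unfolding weight_def using assms
    by (intro sum.mono_neutral_left) (auto simp: unknowns_def in_keys_iff)
  also have "\<dots> = (\<Sum>i\<in>{1..n}. \<Sum>v\<in>{X i, Y i, Z i}. g v * lookup m v)"
    unfolding unknowns_def by (rule sum.UNION_disjoint) auto
  finally show ?thesis by (simp add: add_ac)
qed

text \<open>Turns a one-sided comparison of exponents with fixed total into equality; used first for
  the xy-degrees and then for the x.\<close>

lemma sum_eq_if_comparable:
  fixes f g :: "nat \<Rightarrow> nat"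
  assumes "sum f {1..n} = sum g {1..n}" "(\<forall>i. f i \<le> g i) \<or> (\<forall>i. g i \<le> f i)"
    and "\<And>i. i \<notin> {1..n} \<Longrightarrow> f i = g i"
  shows "f i = g i"
proof (cases "i \<in> {1..n}")
  case True
  then show ?thesis
    using sum_mono_inv[of f "{1..n}" g i] sum_mono_inv[of g "{1..n}" f i] assms(1,2) by auto
qed (use assms(3) in simp)

text \<open>
  In a standard monomial the xy-degrees fill an interval of the factors completely, up to its two
  end points, and within this interval all y precede all x.
\<close>

lemma standard_unique:
  assumes std: "standard n m" "standard n m'"
    and deg: "\<And>i. xy m i + lookup m (Z i) = xy m' i + lookup m' (Z i)"
    and X: "(\<Sum>i\<in>{1..n}. lookup m (X i)) = (\<Sum>i\<in>{1..n}. lookup m' (X i))"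
    and Y: "(\<Sum>i\<in>{1..n}. lookup m (Y i)) = (\<Sum>i\<in>{1..n}. lookup m' (Y i))"
    and below: "\<And>i. i < p \<Longrightarrow> xy m i = 0 \<and> xy m' i = 0"
    and p: "lookup m (Z p) = lookup m' (Z p)" "xy m p > 0"
  shows "m = m'"
proof -
  have p': "xy m p = xy m' p" "xy m' p > 0" using deg[of p] p by auto
  \<comment> \<open>Suppose m' has the larger xy-degree in factor i, so i > p. Then m' has an x or y
    at both p and i, hence no z strictly between, and its xy-degree there is the full degree of the
    factor. Since the degrees agree, m has a z at i, hence no x or y to the right of i.\<close>
  have le: "\<forall>j. xy m j \<le> xy m' j" if less: "xy m i < xy m' i" for i
  proof
    fix j
    have "\<not> i < p" "i \<noteq> p" using less p'(1) below[of i] by auto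
    then have "i > p" by simp
    consider "j < p" | "j = p" | "p < j" "j < i" | "j = i" | "i < j"
      by linarith
    then show "xy m j \<le> xy m' j"
    proof cases
      case 3
      then have "lookup m' (Z j) = 0"
        using standardD(3)[OF std(2), of p j i] p'(2) less by auto
      then show ?thesis using deg[of j] by simp
    next
      case 5
      have "lookup m (Z i) > 0" using less deg[of i] by simp
      then show ?thesis using standardD(3)[OF std(1), of p i j] \<open>i > p\<close> 5 p(2) by auto
    qed (use p'(1) below less in auto)
  qed
  have xy: "xy m i = xy m' i" for i
  proof (rule sum_eq_if_comparable[of "xy m" n "xy m'"])
    show "sum (xy m) {1..n} = sum (xy m') {1..n}"
      using X Y by (simp add: xy_def sum.distrib)
    show "(\<forall>i. xy m i \<le> xy m' i) \<or> (\<forall>i. xy m' i \<le> xy m i)"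
    proof (cases "\<exists>i. xy m i < xy m' i")
      case True
      then show ?thesis using le by blast
    next
      case False
      then show ?thesis by (simp add: not_less)
    qed
  next
    fix i assume "i \<notin> {1..n}"
    then show "xy m i = xy m' i"
      using std[THEN standardD(1)] by (simp add: xy_def lookup_outside)
  qed
  \<comment> \<open>If m has fewer x_i than m', it contains y_i, so it has no x to the left of i. As
    m' contains x_i, it has no y to the right of i, and its x fill the xy-degree there.\<close>
  have leX: "\<forall>j. lookup m (X j) \<le> lookup m' (X j)"
    if less: "lookup m (X i) < lookup m' (X i)" for i
  proof
    fix j
    have "lookup m (Y i) > 0" using less xy[of i] by (simp add: xy_def)
    consider "j < i" | "j = i" | "i < j" by linarith
    then show "lookup m (X j) \<le> lookup m' (X j)"
    proof cases
      case 1
      then show ?thesis using standardD(2)[OF std(1), of j i] \<open>lookup m (Y i) > 0\<close> by auto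
    next
      case 3
      then have "lookup m' (Y j) = 0" using standardD(2)[OF std(2), of i j] less by auto
      then show ?thesis using xy[of j] by (simp add: xy_def)
    qed (use less in auto)
  qed
  have X': "lookup m (X i) = lookup m' (X i)" for i
  proof (rule sum_eq_if_comparable[of "\<lambda>i. lookup m (X i)" n "\<lambda>i. lookup m' (X i)"])
    show "(\<forall>i. lookup m (X i) \<le> lookup m' (X i)) \<or> (\<forall>i. lookup m' (X i) \<le> lookup m (X i))"
    proof (cases "\<exists>i. lookup m (X i) < lookup m' (X i)")
      case True
      then show ?thesis using leX by blast
    next
      case False
      then show ?thesis by (simp add: not_less)
    qed
  next
    fix i assume "i \<notin> {1..n}"
    then show "lookup m (X i) = lookup m' (X i)"
      using std[THEN standardD(1)] by (simp add: lookup_outside)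
  qed (rule X)
  show ?thesis
  proof (rule poly_mapping_eqI)
    fix v
    show "lookup m v = lookup m' v"
      using X' xy deg by (cases v) (auto simp: xy_def)
  qed
qed

text \<open>Let p be the leftmost factor in which some monomial of A has an x or y, and m1 a
  monomial with the fewest z_p, that is, with the largest xy-degree at p. A tie at p would force
  equality by \<open>standard_unique\<close>.\<close>

lemma leftmost_standard:
  assumes "finite A" "A \<noteq> {}" and std: "\<And>m. m \<in> A \<Longrightarrow> standard n m"
    and wt: "\<And>m m' g. m \<in> A \<Longrightarrow> m' \<in> A \<Longrightarrow> g \<in> gradings n \<Longrightarrow> weight g m = weight g m'"
    and n: "n \<ge> 1"
  obtains p m1 where "m1 \<in> A" "p \<in> {1..n}"
    "\<And>m. m \<in> A \<Longrightarrow> m \<noteq> m1 \<Longrightarrow> lookup m1 (Z p) < lookup m (Z p)"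
proof -
  have deg: "xy m i + lookup m (Z i) = xy m' i + lookup m' (Z i)" if "m \<in> A" "m' \<in> A" for m m' i
  proof (cases "i \<in> {1..n}")
    case True
    have eq: "(\<Sum>j\<in>{1..n}. of_bool (j = i) * lookup m (X j) + of_bool (j = i) * lookup m (Y j)
        + of_bool (j = i) * lookup m (Z j)) = xy m i + lookup m (Z i)" for m
    proof -
      have "(\<Sum>j\<in>{1..n}. of_bool (j = i) * lookup m (X j) + of_bool (j = i) * lookup m (Y j)
        + of_bool (j = i) * lookup m (Z j)) = (\<Sum>j\<in>{1..n}. if j = i then xy m j + lookup m (Z j) else 0)"
        by (rule sum.cong) (auto simp: xy_def)
      then show ?thesis using True by simp
    qed
    have "(\<lambda>v. of_bool (index v = i)) \<in> gradings n"
      using True by (auto simp: gradings_def)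
    from wt[OF that this] show ?thesis
      using std[OF that(1), THEN standardD(1)] std[OF that(2), THEN standardD(1)]
      by (simp only: weight_unknowns index.simps eq)
  next
    case False
    have "lookup m0 v = 0" if "index v = i" "m0 \<in> A" for v m0
    proof (rule lookup_outside)
      show "keys m0 \<subseteq> unknowns n" using std[OF that(2)] by (rule standardD(1))
      show "index v \<notin> {1..n}" using False unfolding that(1) .
    qed
    with \<open>m \<in> A\<close> \<open>m' \<in> A\<close> show ?thesis by (simp add: xy_def)
  qed
  have sums: "(\<Sum>i\<in>{1..n}. lookup m (X i)) = (\<Sum>i\<in>{1..n}. lookup m' (X i))"
    "(\<Sum>i\<in>{1..n}. lookup m (Y i)) = (\<Sum>i\<in>{1..n}. lookup m' (Y i))"
    if "m \<in> A" "m' \<in> A" for m m'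
    using wt[OF that, of "\<lambda>v. of_bool (block v = 0)"] wt[OF that, of "\<lambda>v. of_bool (block v = 1)"]
      std[OF that(1), THEN standardD(1)] std[OF that(2), THEN standardD(1)]
    by (simp_all add: weight_unknowns gradings_def)
  show thesis
  proof (cases "\<exists>i. \<exists>m\<in>A. xy m i > 0")
    case False
    \<comment> \<open>Without any x or y the factor degrees determine the monomial, so A is a
      singleton and the choice of p is arbitrary.\<close>
    obtain m1 where "m1 \<in> A" using assms(2) by blast
    have all_eq: "m = m1" if "m \<in> A" for m
    proof (rule poly_mapping_eqI)
      fix v
      have "xy m (index v) = 0" "xy m1 (index v) = 0" using False that \<open>m1 \<in> A\<close> by auto
      then show "lookup m v = lookup m1 v"
        using deg[OF that \<open>m1 \<in> A\<close>, of "index v"] by (cases v) (simp_all add: xy_def)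
    qed
    show thesis
    proof (rule that[of m1 1])
      show "lookup m1 (Z 1) < lookup m (Z 1)" if "m \<in> A" "m \<noteq> m1" for m
        using all_eq[OF that(1)] that(2) by contradiction
    qed (use \<open>m1 \<in> A\<close> n in simp_all)
  next
    case True
    define p where "p = (LEAST i. \<exists>m\<in>A. xy m i > 0)"
    obtain m where m: "m \<in> A" "xy m p > 0"
      using LeastI_ex[OF True] unfolding p_def by blast
    have below: "xy m i = 0" if "i < p" "m \<in> A" for m i
      using not_less_Least[of i "\<lambda>i. \<exists>m\<in>A. xy m i > 0"] that unfolding p_def
      by (meson neq0_conv)
    define m1 where "m1 = arg_min_on (\<lambda>m. lookup m (Z p)) A"
    have m1: "m1 \<in> A" "\<And>m. m \<in> A \<Longrightarrow> lookup m1 (Z p) \<le> lookup m (Z p)"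
      unfolding m1_def using assms(1,2) by (auto intro: arg_min_if_finite(1) arg_min_least)
    \<comment> \<open>m1 has at most as many z_p as m, hence at least the xy-degree of m at
      p.\<close>
    have "xy m1 p > 0" using deg[OF m(1) m1(1), of p] m m1(2)[OF m(1)] by linarith
    moreover have "p \<in> {1..n}"
    proof (rule ccontr)
      assume "p \<notin> {1..n}"
      then have "index (X p) \<notin> {1..n}" "index (Y p) \<notin> {1..n}" by simp_all
      note this[THEN lookup_outside[OF standardD(1)[OF std[OF m(1)]]]]
      then show False using m(2) by (simp add: xy_def)
    qed
    moreover have "lookup m1 (Z p) \<noteq> lookup m (Z p)" if "m \<in> A" "m \<noteq> m1" for m
    proof
      assume "lookup m1 (Z p) = lookup m (Z p)"
      then have "m1 = m"
        using below m1(1) that(1) \<open>xy m1 p > 0\<close>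
        by (intro standard_unique[OF std[OF m1(1)] std[OF that(1)] deg[OF m1(1) that(1)]
            sums[OF m1(1) that(1)], of p]) auto
      then show False using that(2) by simp
    qed
    ultimately show thesis using that[of m1 p] m1 by (meson le_neq_implies_less)
  qed
qed

text \<open>Restrict to monomials with the same weight in every grading and to the line w = T - t_p.
  There z_p becomes T, so the leftmost monomial contributes the lowest power of T and nothing can
  cancel it.\<close>

lemma standard_independent:
  fixes f :: "'k::field poly fract mpoly"
  assumes std: "\<And>m. m \<in> keys f \<Longrightarrow> standard n m"
    and vanish: "\<And>a. a \<in> views n \<Longrightarrow> eval_at a f = 0" and n: "n \<ge> 1"
  shows "f = 0"
proof (rule ccontr)
  assume "f \<noteq> 0"
  then obtain m0 where m0: "m0 \<in> keys f" by (metis equals0I keys_eq_empty)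
  define A where "A = {m \<in> keys f. \<forall>g\<in>gradings n. weight g m = weight g m0}"
  have finG: "finite (gradings n)" by (simp add: gradings_def)
  have sum0: "(\<Sum>m\<in>A. lookup f m * mono_eval a m) = 0" if "a \<in> views n" for a
    unfolding A_def
    by (rule graded_components_vanish[OF finG subset_refl _ _ that])
      (use vanish in \<open>simp_all add: eval_at_superset[OF _ subset_refl]\<close>)
  have "finite A" "A \<noteq> {}" using m0 by (auto simp: A_def)
  then obtain p m1 where p: "m1 \<in> A" "p \<in> {1..n}"
    "\<And>m. m \<in> A \<Longrightarrow> m \<noteq> m1 \<Longrightarrow> lookup m1 (Z p) < lookup m (Z p)"
    by (rule leftmost_standard[of A n]) (use std n in \<open>auto simp: A_def\<close>)
  define t where "t i = (eps :: 'k poly fract) ^ (n - i)" for i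
  \<comment> \<open>\<open>F v\<close> is the value of v at l = x = y = s = 1 and w = T - t_p, as a
    polynomial in T; \<open>R m\<close> collects all factors of m except the powers of z_p.\<close>
  define F where "F v = (case v of Z i \<Rightarrow> [:t i - t p, 1:] | _ \<Rightarrow> 1)" for v
  define R where "R m = (\<Prod>v\<in>keys m - {Z p}. F v ^ lookup m v)" for m
  have split: "(\<Prod>v\<in>keys m. F v ^ lookup m v) = Polynomial.monom 1 (lookup m (Z p)) * R m" for m
  proof -
    have "(\<Prod>v\<in>keys m. F v ^ lookup m v) = F (Z p) ^ lookup m (Z p) * R m"
      unfolding R_def
      by (cases "Z p \<in> keys m") (simp_all add: prod.remove in_keys_iff)
    moreover have "F (Z p) = Polynomial.monom 1 1" by (simp add: F_def monom_altdef)
    ultimately show ?thesis by (simp add: monom_power)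
  qed
  define Q where "Q = (\<Sum>m\<in>A. Polynomial.smult (lookup f m) (Polynomial.monom 1 (lookup m (Z p)) * R m))"
  have "poly Q T = 0" for T
  proof -
    have v: "view n (\<lambda>_. 1) 1 1 1 (T - t p) = (\<lambda>v. poly (F v) T)"
      by (rule ext, case_tac v) (auto simp: F_def t_def)
    have "view n (\<lambda>_. 1) 1 1 1 (T - t p) \<in> views n" by (fastforce simp: views_def)
    then have "(\<Sum>m\<in>A. lookup f m * mono_eval (\<lambda>v. poly (F v) T) m) = 0"
      using sum0 unfolding v by blast
    then show ?thesis
      unfolding Q_def split[symmetric] by (simp add: poly_sum poly_prod mono_eval_def)
  qed
  then have "Q = 0" using poly_zero_if_nonzero_roots by blast
  let ?k = "lookup m1 (Z p)"
  \<comment> \<open>Every other monomial of A contributes a multiple of a higher power of T.\<close>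
  have "Polynomial.coeff Q ?k = (\<Sum>m\<in>A. if m = m1 then lookup f m1 * poly (R m1) 0 else 0)"
    unfolding Q_def Polynomial.coeff_sum
    by (rule sum.cong) (use p(3) in \<open>auto simp: coeff_monom_mult poly_0_coeff_0\<close>)
  also have "\<dots> = lookup f m1 * poly (R m1) 0"
    using \<open>finite A\<close> p(1) by simp
  finally have "lookup f m1 * poly (R m1) 0 = 0" using \<open>Q = 0\<close> by simp
  moreover have "lookup f m1 \<noteq> 0" using p(1) by (auto simp: A_def in_keys_iff)
  \<comment> \<open>For \<open>Z i\<close> with i different from p this is t_i - t_p; it is nonzero
    because n - i and n - p differ for i, p in 1..n.\<close>
  moreover have "poly (F v) 0 \<noteq> 0" if "v \<in> keys m1 - {Z p}" for v
  proof -
    have "index v \<in> {1..n}"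
      using that p(1) std[of m1, THEN standardD(1)] lookup_outside[of m1 n v]
      by (auto simp: A_def in_keys_iff)
    then show ?thesis using that p(2)
      by (cases v) (auto simp: F_def t_def eps_power_inj)
  qed
  then have "poly (R m1) 0 \<noteq> 0" by (simp add: R_def poly_prod)
  ultimately show False by simp
qed

subsection \<open>Normal forms\<close>

definition L_gens :: "nat \<Rightarrow> 'k::field mpoly set" where
  "L_gens n = quadrics n \<union>
     (\<Union>(i, j, k)\<in>{(i, j, k). 1 \<le> i \<and> i < j \<and> j < k \<and> k \<le> n}.
        {indet (X i) * indet (Z j) * indet (X k) - indet (Z i) * indet (X j) * indet (X k),
         indet (Y i) * indet (Z j) * indet (Y k) - indet (Z i) * indet (Y j) * indet (Y k),
         indet (Y i) * indet (Z j) * indet (X k) - indet (Z i) * indet (Y j) * indet (X k)})"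

lemma L_ideal_eq: "L_ideal n = genideal (mpoly_ring n) (L_gens n)"
  by (simp add: L_ideal_def L_gens_def)

text \<open>Treats the three cubic families u_i z_j v_k uniformly. The pair (X, Y) is left out, as
  x_i y_k is already the leading monomial of a quadric.\<close>

definition admissible :: "(nat \<Rightarrow> unknown) \<Rightarrow> (nat \<Rightarrow> unknown) \<Rightarrow> bool" where
  "admissible U V \<longleftrightarrow> U = X \<and> V = X \<or> U = Y \<and> V = Y \<or> U = Y \<and> V = X"

lemma L_gens_cases:
  assumes "f \<in> L_gens n"
  obtains i j where "1 \<le> i" "i < j" "j \<le> n" "f = indet (X i) * indet (Y j) - indet (X j) * indet (Y i)"
  | i j k U V where "1 \<le> i" "i < j" "j < k" "k \<le> n" "admissible U V"
    "f = indet (U i) * indet (Z j) * indet (V k) - indet (Z i) * indet (U j) * indet (V k)"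
  using assms unfolding L_gens_def quadrics_def admissible_def by blast

lemma L_gens_cubic:
  "\<lbrakk>1 \<le> i; i < j; j < k; k \<le> n; admissible U V\<rbrakk> \<Longrightarrow>
    indet (U i) * indet (Z j) * indet (V k) - indet (Z i) * indet (U j) * indet (V k) \<in> L_gens n"
  unfolding L_gens_def admissible_def by blast

lemma G_set_cases:
  assumes "f \<in> G_set n"
  obtains i j where "1 \<le> i" "i < j" "j \<le> n" "f = indet (X i) * indet (Y j) - indet (X j) * indet (Y i)"
  | i j k U V where "1 \<le> i" "i < j" "j < k" "k \<le> n" "admissible U V" "f = cubic n i j k U V"
  using assms unfolding G_set_def quadrics_def admissible_def by blast

lemma G_set_cubic:
  "\<lbrakk>1 \<le> i; i < j; j < k; k \<le> n; admissible U V\<rbrakk> \<Longrightarrow> cubic n i j k U V \<in> G_set n"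
  unfolding G_set_def admissible_def by blast

lemma unknowns_iff: "v \<in> unknowns n \<longleftrightarrow> index v \<in> {1..n}"
  by (cases v) (auto simp: unknowns_def)

lemma admissible_index: "admissible U V \<Longrightarrow> index (U i) = i \<and> index (V i) = i"
  by (auto simp: admissible_def)

lemma G_set_mpolys: "G_set n \<subseteq> mpolys n"
proof
  fix f assume "f \<in> G_set n"
  then show "f \<in> mpolys n"
    by (cases rule: G_set_cases)
      (auto simp: cubic_def unknowns_iff admissible_index
        intro!: mpolys_add mpolys_diff mpolys_mult mpolys_indet mpolys_const)
qed

lemma L_gens_mpolys: "L_gens n \<subseteq> mpolys n"
proof
  fix f assume "f \<in> L_gens n"
  then show "f \<in> mpolys n"
    by (cases rule: L_gens_cases)
      (auto simp: unknowns_iff admissible_index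
        intro!: mpolys_diff mpolys_mult mpolys_indet)
qed

abbreviation "G_ideal n \<equiv> genideal (mpoly_ring n) (G_set n)"

lemma ideal_G: "ideal (G_ideal n) (mpoly_ring n)"
  by (rule genideal_ideal[OF G_set_mpolys])

lemma ideal_L: "ideal (L_ideal n) (mpoly_ring n)"
  unfolding L_ideal_eq by (rule genideal_ideal[OF L_gens_mpolys])

lemma
  assumes "ideal I (mpoly_ring n)"
  shows ideal_add: "f \<in> I \<Longrightarrow> g \<in> I \<Longrightarrow> f + g \<in> I"
    and ideal_mult: "f \<in> I \<Longrightarrow> g \<in> mpolys n \<Longrightarrow> g * f \<in> I"
    and ideal_subset: "I \<subseteq> mpolys n"
    and ideal_diff: "f \<in> I \<Longrightarrow> g \<in> I \<Longrightarrow> f - g \<in> I"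
proof -
  have "- 1 \<in> mpolys n" by (rule mpolys_uminus) (simp add: mpolys_def)
  then have "- g \<in> I" if "g \<in> I"
    using assms that unfolding ideal_mpoly_ring_iff by (metis mult_minus1)
  then show "f \<in> I \<Longrightarrow> g \<in> I \<Longrightarrow> f - g \<in> I"
    using assms unfolding ideal_mpoly_ring_iff by (metis add_uminus_conv_diff)
qed (use assms in \<open>auto simp: ideal_mpoly_ring_iff\<close>)

text \<open>
  Congruence modulo this set is congruence modulo G over K(eps) and, at eps = 0, congruence modulo L.
\<close>

definition good :: "nat \<Rightarrow> 'k::field poly fract mpoly set" where
  "good n = {f \<in> integral_polys. f \<in> G_ideal n \<and> reduce f \<in> L_ideal n}"

lemma good_add: "f \<in> good n \<Longrightarrow> g \<in> good n \<Longrightarrow> f + g \<in> good n"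
  by (auto simp: good_def integral_polys_add reduce_add
      intro: ideal_add[OF ideal_G] ideal_add[OF ideal_L])

lemma good_mult: "f \<in> good n \<Longrightarrow> g \<in> integral_polys \<Longrightarrow> g \<in> mpolys n \<Longrightarrow> g * f \<in> good n"
  by (auto simp: good_def integral_polys_mult reduce_mult mpolys_reduce
      intro: ideal_mult[OF ideal_G] ideal_mult[OF ideal_L])

lemma integral_polys_indet: "indet v \<in> integral_polys"
  unfolding indet_def by (intro integral_polys_single val_ring_consts)

lemma integral_polys_const: "c \<in> val_ring \<Longrightarrow> const c \<in> integral_polys"
  unfolding const_def by (rule integral_polys_single)

lemma integral_polys_diff: "f \<in> integral_polys \<Longrightarrow> g \<in> integral_polys \<Longrightarrow> f - g \<in> integral_polys"
  using integral_polys_add[of f "- g"] integral_polys_uminus[of g] by simp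

lemma reduce_diff:
  "f \<in> integral_polys \<Longrightarrow> g \<in> integral_polys \<Longrightarrow> reduce (f - g) = reduce f - reduce g"
  using reduce_add[of f "- g"] integral_polys_uminus[of g] by (simp add: reduce_uminus)

lemma reduce_indet: "reduce (indet v) = indet v"
  by (simp add: indet_def reduce_single residue_consts)

lemma reduce_const: "reduce (const c) = const (residue c)"
  by (simp add: const_def reduce_single)

lemmas integral_intros = integral_polys_add integral_polys_diff integral_polys_mult
  integral_polys_indet integral_polys_const

lemma const_simps: "const (a + b) = const a + const b" "const (a * b) = const a * const b"
  "const 0 = 0" "const 1 = 1"
  by (simp_all add: const_def single_add mult_single)

lemma good_quadric:
  assumes "1 \<le> i" "i < j" "j \<le> n"
  shows "indet (X i) * indet (Y j) - indet (X j) * indet (Y i) \<in> (good n :: 'k::field poly fract mpoly set)"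
proof -
  have "indet (X i) * indet (Y j) - indet (X j) * indet (Y i) \<in> (quadrics n :: 'k poly fract mpoly set)"
    and "indet (X i) * indet (Y j) - indet (X j) * indet (Y i) \<in> (quadrics n :: 'k mpoly set)"
    using assms unfolding quadrics_def by blast+
  then show ?thesis
    unfolding good_def L_ideal_eq
    by (auto simp: integral_intros reduce_diff reduce_mult reduce_indet G_set_def L_gens_def
        intro!: subsetD[OF genideal_superset])
qed

text \<open>Multiplying \<open>cubic\<close> by 1 / (t_k - t_i) makes its leading coefficient 1 and
  the others integral. At eps = 0 the third term disappears and a generator of L remains.\<close>

lemma good_cubic:
  fixes n i j k :: nat
  assumes "1 \<le> i" "i < j" "j < k" "k \<le> n" "admissible U V"
  defines "t \<equiv> \<lambda>i. (eps :: 'k::field poly fract) ^ (n - i)"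
  shows "indet (U i) * indet (Z j) * indet (V k)
    - const ((t j - t k) / (t i - t k)) * (indet (Z i) * indet (U j) * indet (V k))
    - const ((t i - t j) / (t i - t k)) * (indet (U i) * indet (V j) * indet (Z k)) \<in> good n"
    (is "?f \<in> _")
proof -
  have q: "(t j - t k) / (t i - t k) \<in> val_ring" "residue ((t j - t k) / (t i - t k)) = 1"
    "(t i - t j) / (t i - t k) \<in> val_ring" "residue ((t i - t j) / (t i - t k)) = 0"
    unfolding t_def by (rule residue_eps_quotients[OF assms(2-4)])+
  have ne: "t i - t k \<noteq> 0" using assms(1-4) by (simp add: t_def eps_power_inj)
  \<comment> \<open>The quotients have denominator t_i - t_k, the negative of the leading
    coefficient of \<open>cubic\<close>; this gives the minus signs in \<open>c\<close>.\<close>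
  let ?c = "1 / (t k - t i)"
  have c: "?c * (t k - t i) = 1" "?c * (t j - t k) = - ((t j - t k) / (t i - t k))"
    "?c * (t i - t j) = - ((t i - t j) / (t i - t k))"
  proof -
    have neg: "?c = - (1 / (t i - t k))" unfolding minus_divide_right by simp
    show "?c * (t j - t k) = - ((t j - t k) / (t i - t k))"
      "?c * (t i - t j) = - ((t i - t j) / (t i - t k))" unfolding neg by simp_all
    have "t k - t i \<noteq> 0" using ne by auto
    then show "?c * (t k - t i) = 1" by simp
  qed
  have "const ?c * cubic n i j k U V =
      const (?c * (t k - t i)) * (indet (U i) * indet (Z j) * indet (V k)) +
      const (?c * (t j - t k)) * (indet (Z i) * indet (U j) * indet (V k)) +
      const (?c * (t i - t j)) * (indet (U i) * indet (V j) * indet (Z k))"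
    unfolding const_simps cubic_def t_def by (simp only: algebra_simps)
  also have "\<dots> = ?f"
    unfolding c by (simp add: const_def single_uminus)
  finally have eq: "const ?c * cubic n i j k U V = ?f" .
  have "(cubic n i j k U V :: 'k poly fract mpoly) \<in> G_ideal n"
    by (rule subsetD[OF genideal_superset G_set_cubic[OF assms(1-5)]])
  from ideal_mult[OF ideal_G this mpolys_const[of ?c]] have "?f \<in> G_ideal n"
    unfolding eq .
  moreover have int: "?f \<in> integral_polys"
    by (intro integral_intros q)
  moreover have "reduce ?f =
      indet (U i) * indet (Z j) * indet (V k) - indet (Z i) * indet (U j) * indet (V k)"
    by (simp add: reduce_diff reduce_mult integral_intros q reduce_indet reduce_const const_simps)
  moreover have "\<dots> \<in> L_ideal n"
    unfolding L_ideal_eq by (rule subsetD[OF genideal_superset L_gens_cubic[OF assms(1-5)]])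
  ultimately show ?thesis by (simp add: good_def)
qed

text \<open>
  With e = xy m this counts the z strictly between the extreme factors that contain x or y. Applied at
  these extreme factors, the rewriting by a cubic moves an x or y into such a position and the z out to
  the end, so the count drops for both summands.
\<close>

definition hole :: "nat \<Rightarrow> (nat \<Rightarrow> nat) \<Rightarrow> (nat \<Rightarrow> nat) \<Rightarrow> nat" where
  "hole n e z = (\<Sum>l\<in>{l\<in>{1..n}. (\<exists>i<l. 0 < e i) \<and> (\<exists>k>l. 0 < e k)}. z l)"

text \<open>\<open>z0\<close> stands for the z-exponents left after z_j has been removed. The new
  exponents exceed \<open>z0\<close> at most outside the inner positions, the set of inner positions
  does not grow, and the removed z_j was at an inner position.\<close>

lemma hole_less:
  assumes "{l\<in>{1..n}. (\<exists>i<l. 0 < e' i) \<and> (\<exists>k>l. 0 < e' k)} \<subseteq>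
      {l\<in>{1..n}. (\<exists>i<l. 0 < e i) \<and> (\<exists>k>l. 0 < e k)}"
    and "\<And>l. (\<exists>i<l. 0 < e' i) \<Longrightarrow> (\<exists>k>l. 0 < e' k) \<Longrightarrow> z' l \<le> z0 l"
    and "\<And>l. z l = z0 l + of_bool (l = j)"
    and "j \<in> {1..n}" "i < j" "0 < e i" "j < k" "0 < e k"
  shows "hole n e' z' < hole n e z"
proof -
  let ?S = "\<lambda>e. {l\<in>{1..n}. (\<exists>i<l. 0 < e i) \<and> (\<exists>k>l. 0 < e k)}"
  have "hole n e' z' \<le> sum z0 (?S e')"
    unfolding hole_def by (rule sum_mono) (use assms(2) in auto)
  also have "\<dots> \<le> sum z0 (?S e)"
    by (rule sum_mono2) (use assms(1) in auto)
  also have "\<dots> < hole n e z"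
    unfolding hole_def by (rule sum_strict_mono_ex1) (use assms(3-8) in auto)
  finally show ?thesis .
qed

section \<open>Factors of monomials and lexicographic comparison\<close>

lemma monomial_split:
  fixes m d :: monomial
  assumes "\<And>v. lookup d v \<le> lookup m v"
  obtains m0 where "m = m0 + d"
proof
  show "m = (m - d) + d"
    by (rule poly_mapping_eqI) (simp add: lookup_add lookup_minus assms)
qed

abbreviation "var \<equiv> (\<lambda>v::unknown. single v (1::nat))"

lemma lookup_var:
  "lookup (var v) w = of_bool (v = w)" "lookup (single v (Suc 0)) w = of_bool (v = w)"
  by (simp_all add: lookup_single "when_def")

lemma indet_prod2: "indet u * indet v = single (var u + var v) 1"
  by (simp add: indet_def mult_single)

lemma indet_prod3: "indet u * indet v * indet w = single (var u + var v + var w) 1"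
  by (simp add: indet_def mult_single)

lemma keys_monomial_add:
  fixes a b :: monomial
  shows "keys (a + b) = keys a \<union> keys b"
  by (auto simp: in_keys_iff lookup_add)

text \<open>\<open>u\<close> is the most significant of the four unknowns, being the least in the
  order on \<open>unknown\<close>. The exponents first differ there, and the right side is
  larger.\<close>

lemma swap_lower:
  fixes m :: monomial
  assumes "u < v'" "u < w" "u < w'"
  shows "m + (var v' + var w) < m + (var u + var w')"
  unfolding monomial_less_iff
  by (rule exI[of _ u]) (use assms in \<open>auto simp: lookup_add lookup_var\<close>)

text \<open>\<open>r\<close> is a normal form of m. The bound b <= m is required only for
  coefficients that survive at eps = 0, because the B-term of a cubic is lexicographically larger
  than the monomial it replaces. The last clause fixes the normal form of a standard
  monomial.\<close>

definition reducible :: "nat \<Rightarrow> monomial \<Rightarrow> 'k::field poly fract mpoly \<Rightarrow> bool" where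
  "reducible n m r \<longleftrightarrow> r \<in> integral_polys \<and> (\<forall>b\<in>keys r. standard n b) \<and>
     single m 1 - r \<in> good n \<and> (\<forall>b. residue (lookup r b) \<noteq> 0 \<longrightarrow> b \<le> m) \<and>
     (standard n m \<longrightarrow> r = single m 1)"

lemma good_zero: "(0 :: 'k::field poly fract mpoly) \<in> good n"
proof -
  have "reduce (0 :: 'k poly fract mpoly) = 0"
    by (rule poly_mapping_eqI) (simp add: lookup_reduce residue_consts)
  moreover have "(0 :: 'k mpoly) \<in> L_ideal n" "(0 :: 'k poly fract mpoly) \<in> G_ideal n"
    using ideal_L ideal_G unfolding ideal_mpoly_ring_iff by blast+
  ultimately show ?thesis
    by (simp add: good_def integral_polys_def val_ring_consts)
qed

lemma reducible_standard: "standard n m \<Longrightarrow> reducible n m (single m 1)"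
  by (simp add: reducible_def integral_polys_single val_ring_consts good_zero lookup_single
      "when_def" residue_consts)

lemma lookup_const_mult: "lookup (const c * f) m = c * lookup f m"
  unfolding const_def mult_map_scale_conv_mult[symmetric]
  by (simp add: Poly_Mapping.map.rep_eq "when_def")

text \<open>The part from m2 has coefficients that vanish at eps = 0, so the lexicographic bound
  comes from m1 alone.\<close>

lemma reducible_combine:
  fixes r1 r2 :: "'k::field poly fract mpoly"
  assumes "\<not> standard n m" "A \<in> val_ring" "B \<in> val_ring" "residue B = 0"
    and good: "single m 1 - const A * single m1 1 - const B * single m2 1 \<in> good n" and "m1 \<le> m"
    and r1: "reducible n m1 r1" and r2: "reducible n m2 r2"
  shows "reducible n m (const A * r1 + const B * r2)"
proof -
  let ?r = "const A * r1 + const B * r2"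
  have int: "r1 \<in> integral_polys" "r2 \<in> integral_polys"
    and g: "single m1 1 - r1 \<in> good n" "single m2 1 - r2 \<in> good n"
    using r1 r2 unfolding reducible_def by blast+
  have v: "lookup r1 b \<in> val_ring" "lookup r2 b \<in> val_ring" for b
    using int by (simp_all add: integral_polys_def)
  have "?r \<in> integral_polys"
    by (intro integral_intros int assms(2,3))
  moreover have "standard n b" if "b \<in> keys ?r" for b
  proof -
    have "b \<in> keys r1 \<or> b \<in> keys r2"
      using that unfolding in_keys_iff lookup_add lookup_const_mult by fastforce
    then show ?thesis using r1 r2 unfolding reducible_def by blast
  qed
  moreover have "b \<le> m" if "residue (lookup ?r b) \<noteq> 0" for b
  proof -
    have "residue (lookup ?r b) = residue A * residue (lookup r1 b)"
      using v[of b] assms(2-4)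
      by (simp add: lookup_add lookup_const_mult residue_add residue_mult val_ring_mult)
    then have "residue (lookup r1 b) \<noteq> 0" using that by auto
    then have "b \<le> m1" using r1 unfolding reducible_def by blast
    then show ?thesis using assms(6) by (rule order_trans)
  qed
  moreover have "single m 1 - ?r \<in> good n"
  proof -
    have "single m 1 - ?r = (single m 1 - const A * single m1 1 - const B * single m2 1)
        + (const A * (single m1 1 - r1) + const B * (single m2 1 - r2))"
      by (simp only: right_diff_distrib) simp
    then show ?thesis
      by (simp only:)
        (intro good_add good good_mult g integral_intros mpolys_const assms(2,3))
  qed
  ultimately show ?thesis using assms(1) unfolding reducible_def by blast
qed

lemma good_single_mult:
  "f \<in> good n \<Longrightarrow> keys m \<subseteq> unknowns n \<Longrightarrow> single m 1 * f \<in> good n"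
  by (rule good_mult) (auto intro: integral_polys_single val_ring_consts mpolys_single)

text \<open>Measure for the quadrics: replacing x_i y_j by x_j y_i with i < j moves a y to the
  left.\<close>

definition y_height :: "nat \<Rightarrow> monomial \<Rightarrow> nat" where
  "y_height n m = (\<Sum>i\<in>{1..n}. i * lookup m (Y i))"

text \<open>Since the B-term is lexicographically larger, the induction is on the pair
  (\<open>hole\<close>, \<open>y_height\<close>). A quadric keeps the first entry and lowers the
  second; a cubic, used only when no quadric applies, lowers the first.\<close>

lemma normal_form:
  assumes "keys m \<subseteq> unknowns n"
  shows "\<exists>r :: 'k::field poly fract mpoly. reducible n m r"
  using assms
proof (induction m rule: wf_induct_rule[OF wf_measures[of
      "[\<lambda>m. hole n (xy m) (\<lambda>l. lookup m (Z l)), y_height n]"]])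
  case (1 m)
  note keys_m = 1(2)
  have in_n: "index v \<in> {1..n}" if "lookup m v > 0" for v
    using lookup_outside[OF keys_m, of v] that by auto
  show ?case
  proof (cases "standard n m")
    case True
    then show ?thesis using reducible_standard by blast
  next
    case nonstd: False
    show ?thesis
    proof (cases "\<exists>i j. i < j \<and> lookup m (X i) > 0 \<and> lookup m (Y j) > 0")
      case True
      then obtain i j where ij: "i < j" "lookup m (X i) > 0" "lookup m (Y j) > 0" by blast
      have "lookup (var (X i) + var (Y j)) v \<le> lookup m v" for v
        using ij by (auto simp: lookup_add lookup_var)
      then obtain m0 where m: "m = m0 + (var (X i) + var (Y j))" by (rule monomial_split)
      define m' where "m' = m0 + (var (X j) + var (Y i))"
      have n: "i \<in> {1..n}" "j \<in> {1..n}" using in_n[of "X i"] in_n[of "Y j"] ij by auto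
      have "xy m' = xy m" "(\<lambda>l. lookup m' (Z l)) = (\<lambda>l. lookup m (Z l))"
        by (auto simp: m m'_def xy_def lookup_add lookup_var)
      moreover have "y_height n m' < y_height n m"
      proof -
        have eq: "y_height n (m0 + (var (X a) + var (Y b))) = y_height n m0 + b"
          if "b \<in> {1..n}" for a b
          using that by (simp add: y_height_def lookup_add lookup_var distrib_left sum.distrib
              flip: of_bool_eq_iff)
        show ?thesis unfolding m m'_def eq[OF n(1)] eq[OF n(2)] using ij(1) by simp
      qed
      ultimately have "(m', m) \<in> measures [\<lambda>m. hole n (xy m) (\<lambda>l. lookup m (Z l)), y_height n]"
        by simp
      moreover have keys: "keys m' \<subseteq> unknowns n" "keys m0 \<subseteq> unknowns n"
        using keys_m n by (auto simp: m m'_def keys_monomial_add unknowns_iff)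
      ultimately obtain r :: "'k poly fract mpoly" where r: "reducible n m' r"
        using 1(1) by blast
      have "single m0 1 * (indet (X i) * indet (Y j) - indet (X j) * indet (Y i)) \<in> good n"
        by (rule good_single_mult[OF good_quadric]) (use ij n keys in auto)
      \<comment> \<open>The quadric is put in the form of \<open>reducible_combine\<close> with A =
        1 and B = 0, so m' can also serve as the second monomial.\<close>
      then have "single m 1 - const 1 * single m' 1 - const 0 * single m' (1 :: 'k poly fract) \<in> good n"
        by (simp add: m m'_def right_diff_distrib indet_prod2 mult_single const_simps)
      moreover have "m' \<le> m"
        unfolding m m'_def
        by (rule less_imp_le, rule swap_lower) (use ij in \<open>auto simp: less_unknown_def\<close>)
      ultimately show ?thesis
        using reducible_combine[OF nonstd val_ring_consts(2,1) residue_consts(1) _ _ r r] by blast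
    next
      case False
      then have sorted: "lookup m (X i) = 0 \<or> lookup m (Y j) = 0" if "i < j" for i j
        using that by auto
      obtain i0 j k0 where ijk0: "i0 < j" "j < k0" "0 < xy m i0" "0 < lookup m (Z j)" "0 < xy m k0"
        using nonstd sorted keys_m unfolding standard_def by blast
      \<comment> \<open>The positions i0 and k0 are replaced by the outermost ones with an x or y;
        only for these does the rewriting lower \<open>hole\<close>.\<close>
      define i where "i = (LEAST i. 0 < xy m i)"
      define k where "k = (GREATEST k. 0 < xy m k)"
      have i: "0 < xy m i" "i \<le> i0" "\<And>l. 0 < xy m l \<Longrightarrow> i \<le> l"
        unfolding i_def using ijk0(3) by (auto intro: LeastI Least_le)
      \<comment> \<open>Boundedness ensures that the \<open>GREATEST\<close> is attained.\<close>
      have bd: "l \<le> n" if "0 < xy m l" for l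
        using that in_n[of "X l"] in_n[of "Y l"] by (auto simp: xy_def)
      have k: "0 < xy m k" "k0 \<le> k" "\<And>l. 0 < xy m l \<Longrightarrow> l \<le> k"
        unfolding k_def
        using GreatestI_nat[of "\<lambda>k. 0 < xy m k" k0 n] Greatest_le_nat[of "\<lambda>k. 0 < xy m k" _ n]
          bd ijk0(5) by auto
      have ijk: "i < j" "j < k" using ijk0(1,2) i(2) k(2) by simp_all
      \<comment> \<open>As no quadric applies, x_i and y_k do not both occur, so an admissible pair
        is available.\<close>
      obtain U V where UV: "admissible U V" "0 < lookup m (U i)" "0 < lookup m (V k)"
      proof (cases "lookup m (X i) = 0")
        case True
        then show thesis using i(1) k(1) that[of Y X] that[of Y Y]
          by (auto simp: xy_def admissible_def)
      next
        case False
        then have "lookup m (Y k) = 0" using sorted[of i k] ijk by simp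
        then show thesis using False k(1) that[of X X] by (auto simp: xy_def admissible_def)
      qed
      have n: "i \<in> {1..n}" "j \<in> {1..n}" "k \<in> {1..n}"
        using in_n[of "Z j"] in_n[OF UV(2)] in_n[OF UV(3)] ijk0 admissible_index[OF UV(1)] by auto
      have "lookup (var (U i) + var (Z j) + var (V k)) v \<le> lookup m v" for v
        using UV ijk0(4) ijk by (auto simp: lookup_add lookup_var admissible_def)
      then obtain m0 where m: "m = m0 + (var (U i) + var (Z j) + var (V k))" by (rule monomial_split)
      define m1 where "m1 = m0 + (var (Z i) + var (U j) + var (V k))"
      define m2 where "m2 = m0 + (var (U i) + var (V j) + var (Z k))"
      have xyz: "xy m l = xy m0 l + of_bool (l = i) + of_bool (l = k)"
        "xy m1 l = xy m0 l + of_bool (l = j) + of_bool (l = k)"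
        "xy m2 l = xy m0 l + of_bool (l = i) + of_bool (l = j)"
        "lookup m (Z l) = lookup m0 (Z l) + of_bool (l = j)"
        "lookup m1 (Z l) = lookup m0 (Z l) + of_bool (l = i)"
        "lookup m2 (Z l) = lookup m0 (Z l) + of_bool (l = k)" for l
        using UV(1) by (auto simp: m m1_def m2_def xy_def lookup_add lookup_var admissible_def)
      \<comment> \<open>Both new monomials keep their x and y between i and k. Hence the new z_i or
        z_k is not at an inner position.\<close>
      have supp: "i \<le> l \<and> l \<le> k" if "0 < xy m1 l \<or> 0 < xy m2 l" for l
        using that i(3)[of l] k(3)[of l] ijk unfolding xyz by (auto split: if_splits)
      have "hole n (xy m1) (\<lambda>l. lookup m1 (Z l)) < hole n (xy m) (\<lambda>l. lookup m (Z l))"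
      proof (rule hole_less[of n "xy m1" "xy m" "\<lambda>l. lookup m1 (Z l)"
            "\<lambda>l. lookup m0 (Z l)" "\<lambda>l. lookup m (Z l)" j i k])
        show "lookup m1 (Z l) \<le> lookup m0 (Z l)" if lower: "\<exists>i<l. 0 < xy m1 i" for l
        proof -
          have "i < l" using lower supp le_less_trans by blast
          then show ?thesis by (simp add: xyz)
        qed
        have "(\<exists>i<l. 0 < xy m i) \<and> (\<exists>k>l. 0 < xy m k)"
          if "(\<exists>i<l. 0 < xy m1 i)" "(\<exists>k>l. 0 < xy m1 k)" for l
          using that supp i(1) k(1) by (metis le_less_trans less_le_trans)
        then show "{l \<in> {1..n}. (\<exists>i<l. 0 < xy m1 i) \<and> (\<exists>k>l. 0 < xy m1 k)} \<subseteq>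
            {l \<in> {1..n}. (\<exists>i<l. 0 < xy m i) \<and> (\<exists>k>l. 0 < xy m k)}" by blast
      qed (use n i(1) k(1) ijk xyz in auto)
      moreover have "hole n (xy m2) (\<lambda>l. lookup m2 (Z l)) < hole n (xy m) (\<lambda>l. lookup m (Z l))"
      proof (rule hole_less[of n "xy m2" "xy m" "\<lambda>l. lookup m2 (Z l)"
            "\<lambda>l. lookup m0 (Z l)" "\<lambda>l. lookup m (Z l)" j i k])
        show "lookup m2 (Z l) \<le> lookup m0 (Z l)" if upper: "\<exists>k>l. 0 < xy m2 k" for l
        proof -
          have "l < k" using upper supp less_le_trans by blast
          then show ?thesis by (simp add: xyz)
        qed
        have "(\<exists>i<l. 0 < xy m i) \<and> (\<exists>k>l. 0 < xy m k)"
          if "(\<exists>i<l. 0 < xy m2 i)" "(\<exists>k>l. 0 < xy m2 k)" for l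
          using that supp i(1) k(1) by (metis le_less_trans less_le_trans)
        then show "{l \<in> {1..n}. (\<exists>i<l. 0 < xy m2 i) \<and> (\<exists>k>l. 0 < xy m2 k)} \<subseteq>
            {l \<in> {1..n}. (\<exists>i<l. 0 < xy m i) \<and> (\<exists>k>l. 0 < xy m k)}" by blast
      qed (use n i(1) k(1) ijk xyz in auto)
      moreover have keys: "keys m0 \<subseteq> unknowns n" "keys m1 \<subseteq> unknowns n" "keys m2 \<subseteq> unknowns n"
        using keys_m n admissible_index[OF UV(1)]
        by (auto simp: m m1_def m2_def keys_monomial_add unknowns_iff)
      ultimately obtain r1 r2 :: "'k poly fract mpoly"
        where r: "reducible n m1 r1" "reducible n m2 r2"
        using 1(1)[of m1] 1(1)[of m2] by auto
      define t where "t i = (eps :: 'k poly fract) ^ (n - i)" for i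
      let ?A = "(t j - t k) / (t i - t k)" and ?B = "(t i - t j) / (t i - t k)"
      have "single m0 1 * (indet (U i) * indet (Z j) * indet (V k)
          - const ?A * (indet (Z i) * indet (U j) * indet (V k))
          - const ?B * (indet (U i) * indet (V j) * indet (Z k))) \<in> good n"
        unfolding t_def by (rule good_single_mult[OF good_cubic]) (use ijk n keys UV(1) in auto)
      then have good: "single m 1 - const ?A * single m1 1 - const ?B * single m2 1 \<in> good n"
        by (simp add: m m1_def m2_def right_diff_distrib indet_prod3 mult_single const_def)
      have "m1 < m"
      proof -
        \<comment> \<open>The common factor v_k is split off; u_i is then the most significant of
          the four exchanged unknowns.\<close>
        have "(m0 + var (V k)) + (var (U j) + var (Z i)) < (m0 + var (V k)) + (var (U i) + var (Z j))"
          by (rule swap_lower) (use ijk UV(1) in \<open>auto simp: less_unknown_def admissible_def\<close>)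
        then show ?thesis by (simp add: m m1_def add_ac)
      qed
      then have "m1 \<le> m" by simp
      have "k \<le> n" using n by simp
      note q = residue_eps_quotients[OF ijk this, where 'k = 'k]
      have "?A \<in> val_ring" "?B \<in> val_ring" "residue ?B = 0"
        unfolding t_def by (rule q)+
      from reducible_combine[OF nonstd this good \<open>m1 \<le> m\<close> r] show ?thesis by blast
    qed
  qed
qed

subsection \<open>The multiview ideal\<close>

lemma vector_4:
  "(vector [a, b, c, d] :: 'a::zero ^ 4) $ 1 = a" "(vector [a, b, c, d] :: 'a ^ 4) $ 2 = b"
  "(vector [a, b, c, d] :: 'a ^ 4) $ 3 = c" "(vector [a, b, c, d] :: 'a ^ 4) $ 4 = d"
  by (simp_all add: vector_def)

lemma camera_apply:
  "camera n i *v u = vector [u $ 1 + u $ 2, u $ 1 + u $ 3, eps ^ (n - i) * u $ 1 + u $ 4]"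
  by (simp add: vec_eq_iff forall_3 matrix_vector_mult_def camera_def sum_4 vector_3 vector_4)

lemma multiview_ideal_vanishes:
  assumes f: "f \<in> multiview_ideal n (camera n)" and a: "a \<in> views n"
  shows "eval_at a f = 0"
proof -
  obtain l x y s w where a: "a = view n l x y s w" and ne: "\<forall>i. l i \<noteq> 0" "x \<noteq> 0"
    using a by (auto simp: views_def)
  \<comment> \<open>This u undoes the change of coordinates: camera i sends it to (x, y, t_i s +
    w).\<close>
  define u :: "'a poly fract ^ 4" where "u = vector [s, x - s, y - s, w]"
  define p where "p i = l i *s (camera n i *v u)" for i
  have Au: "camera n i *v u = vector [x, y, eps ^ (n - i) * s + w]" for i
    by (simp add: camera_apply u_def vector_4)
  have Au0: "camera n i *v u \<noteq> 0" for i
    unfolding Au using ne(2) by (simp add: vec_eq_iff forall_3 vector_3)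
  then have "u \<noteq> 0" by auto
  then have "p \<in> camera_image n (camera n)"
    unfolding camera_image_def p_def using Au0 ne(1) by blast
  moreover have "p i \<noteq> 0" for i using Au0[of i] ne(1) by (simp add: p_def vector_mul_eq_0)
  ultimately have "p \<in> zariski_closure n (camera_image n (camera n))"
    by (auto simp: zariski_closure_def rep_points_def)
  then have "eval_at (coords p) f = 0" using f by (auto simp: multiview_ideal_def)
  moreover have "coords p = a"
  proof
    fix v show "coords p v = a v"
      unfolding a by (cases v) (simp_all add: p_def Au)
  qed
  ultimately show ?thesis by simp
qed

lemma ideal_multiview: "ideal (multiview_ideal n A) (mpoly_ring n)"
  unfolding ideal_mpoly_ring_iff
  by (auto simp: multiview_ideal_def eval_at_simps eval_at_zero mpolys_zero mpolys_add mpolys_mult)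

section \<open>The set G lies in the multiview ideal\<close>

definition mdeg :: "monomial \<Rightarrow> nat \<Rightarrow> nat" where
  "mdeg m i = lookup m (X i) + lookup m (Y i) + lookup m (Z i)"

lemma mdeg_add: "mdeg (a + b) i = mdeg a i + mdeg b i"
  by (simp add: mdeg_def lookup_add)

lemma mdeg_var: "mdeg (single v (Suc 0)) i = of_bool (index v = i)"
  by (cases v) (simp_all add: mdeg_def lookup_var)

lemma multihomogeneous_if_mdeg:
  assumes "\<And>m. m \<in> keys f \<Longrightarrow> mdeg m = d"
  shows "multihomogeneous n f"
proof -
  have "\<forall>m\<in>keys f. \<forall>i\<in>{1..n}. lookup m (X i) + lookup m (Y i) + lookup m (Z i) = d i"
    using assms by (fastforce simp: mdeg_def)
  then show ?thesis unfolding multihomogeneous_def by (intro exI[of _ d])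
qed

text \<open>The closure is defined by multihomogeneous polynomials, so this carries vanishing from
  the image over to its closure.\<close>

lemma multihomogeneous_G:
  assumes "f \<in> G_set n"
  shows "multihomogeneous n f"
  using assms
proof (cases rule: G_set_cases)
  case (1 i j)
  have "f = single (var (X i) + var (Y j)) 1 - single (var (X j) + var (Y i)) 1"
    by (simp only: 1 indet_prod2)
  then have "keys f \<subseteq> {var (X i) + var (Y j), var (X j) + var (Y i)}"
    by (auto simp: in_keys_iff lookup_minus lookup_single "when_def" split: if_splits)
  then show ?thesis
    by (intro multihomogeneous_if_mdeg[of _ "\<lambda>l. of_bool (i = l) + of_bool (j = l)"])
      (auto simp: fun_eq_iff mdeg_add mdeg_var)
next
  case (2 i j k U V)
  have "f = single (var (U i) + var (Z j) + var (V k)) (eps ^ (n - k) - eps ^ (n - i)) +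
      single (var (Z i) + var (U j) + var (V k)) (eps ^ (n - j) - eps ^ (n - k)) +
      single (var (U i) + var (V j) + var (Z k)) (eps ^ (n - i) - eps ^ (n - j))"
    by (simp only: 2 cubic_def mult.assoc) (simp add: const_def indet_def mult_single add_ac)
  then have "keys f \<subseteq> {var (U i) + var (Z j) + var (V k), var (Z i) + var (U j) + var (V k),
      var (U i) + var (V j) + var (Z k)}"
    by (auto simp: in_keys_iff lookup_add lookup_single "when_def" split: if_splits)
  then show ?thesis
    by (intro multihomogeneous_if_mdeg[of _ "\<lambda>l. of_bool (i = l) + of_bool (j = l) + of_bool (k = l)"])
      (auto simp: fun_eq_iff mdeg_add mdeg_var admissible_index[OF 2(5)])
qed

text \<open>For a cubic, the scalings and the values of u and v factor out on the image; what
  remains is (t_k - t_i)(t_j s + w) + (t_j - t_k)(t_i s + w) + (t_i - t_j)(t_k s + w) = 0, with s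
  and w the first and last entry of the source point.\<close>

lemma G_set_multiview: "G_set n \<subseteq> multiview_ideal n (camera n)"
proof
  fix f :: "'k::field poly fract mpoly" assume f: "f \<in> G_set n"
  have "eval_at (coords q) f = 0" if q: "q \<in> camera_image n (camera n)" for q
  proof -
    obtain u where u: "\<And>i. i \<in> {1..n} \<Longrightarrow> \<exists>c. q i = c *s (camera n i *v u)"
      using q unfolding camera_image_def by blast
    then obtain c where c: "\<And>i. i \<in> {1..n} \<Longrightarrow> q i = c i *s (camera n i *v u)" by metis
    have q: "coords q (X i) = c i * (u $ 1 + u $ 2)" "coords q (Y i) = c i * (u $ 1 + u $ 3)"
      "coords q (Z i) = c i * (eps ^ (n - i) * u $ 1 + u $ 4)" if "i \<in> {1..n}" for i
      using c[OF that] by (simp_all add: camera_apply vector_3)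
    from f show ?thesis
    proof (cases rule: G_set_cases)
      case (1 i j)
      then show ?thesis by (simp add: eval_at_simps q del: coords.simps)
    next
      case (2 i j k U V)
      note q = q[of i] q[of j] q[of k]
      show ?thesis using 2
        by (auto simp: cubic_def eval_at_simps q admissible_def algebra_simps simp del: coords.simps)
    qed
  qed
  moreover have "f \<in> mpolys n" using f G_set_mpolys by blast
  moreover have "multihomogeneous n f" using f by (rule multihomogeneous_G)
  ultimately show "f \<in> multiview_ideal n (camera n)"
    by (auto simp: multiview_ideal_def zariski_closure_def)
qed

lemma G_ideal_multiview: "G_ideal n \<subseteq> multiview_ideal n (camera n)"
  by (rule genideal_least[OF ideal_multiview G_set_multiview])

section \<open>Normal forms of elements of the multiview ideal\<close>

definition normal :: "nat \<Rightarrow> monomial \<Rightarrow> 'k::field poly fract mpoly" where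
  "normal n m = (SOME r. reducible n m r)"

lemma reducible_normal: "keys m \<subseteq> unknowns n \<Longrightarrow> reducible n m (normal n m)"
  unfolding normal_def by (rule someI_ex[OF normal_form])

lemma single_eq_const_mult: "single m c = const c * single m 1"
  by (simp add: const_def mult_single)

context
  fixes n :: nat and F :: "'k::field poly fract mpoly"
  assumes n: "n \<ge> 1" and F: "F \<in> multiview_ideal n (camera n)"
begin

abbreviation nf :: "monomial \<Rightarrow> 'k poly fract mpoly" where
  "nf \<equiv> normal n"

lemma keys_multiview: "m \<in> keys F \<Longrightarrow> keys m \<subseteq> unknowns n"
  using F by (auto simp: multiview_ideal_def mpolys_def)

lemma multiview_expansion:
  "F = (\<Sum>m\<in>keys F. const (lookup F m) * (single m 1 - nf m))
     + (\<Sum>m\<in>keys F. const (lookup F m) * nf m)"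
proof -
  have "F = (\<Sum>m\<in>keys F. const (lookup F m) * single m 1)"
    unfolding single_eq_const_mult[symmetric] by (simp add: sum_singles)
  then show ?thesis by (simp add: algebra_simps sum_subtractf)
qed

lemma reduction_sum_in_G: "(\<Sum>m\<in>keys F. const (lookup F m) * (single m 1 - nf m)) \<in> G_ideal n"
proof (intro ideal_sum[OF ideal_G] ideal_mult[OF ideal_G] mpolys_const)
  fix m assume "m \<in> keys F"
  then have "reducible n m (nf m)" by (intro reducible_normal keys_multiview)
  then show "single m 1 - nf m \<in> G_ideal n" unfolding reducible_def good_def by blast
qed

text \<open>The sum differs from F by an element of the ideal of G, so it vanishes on
  \<open>views\<close>; being supported on standard monomials, it is 0.\<close>

lemma normal_sum_zero: "(\<Sum>m\<in>keys F. const (lookup F m) * nf m) = 0" (is "?S = 0")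
proof (rule standard_independent[OF _ _ n])
  have "F - (\<Sum>m\<in>keys F. const (lookup F m) * (single m 1 - nf m)) \<in> multiview_ideal n (camera n)"
    using reduction_sum_in_G G_ideal_multiview F by (intro ideal_diff[OF ideal_multiview]) auto
  then have "?S \<in> multiview_ideal n (camera n)"
    unfolding diff_eq_eq[THEN iffD2, OF trans[OF multiview_expansion add.commute]] .
  then show "eval_at a ?S = 0" if "a \<in> views n" for a
    using that by (rule multiview_ideal_vanishes)
next
  fix b assume "b \<in> keys ?S"
  from subsetD[OF keys_sum this]
  obtain m where m: "m \<in> keys F" "b \<in> keys (const (lookup F m) * nf m)" by (rule UN_E)
  then have "b \<in> keys (nf m)"
    by (auto simp: in_keys_iff lookup_const_mult)
  moreover have "reducible n m (nf m)" by (rule reducible_normal[OF keys_multiview[OF m(1)]])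
  ultimately show "standard n b" unfolding reducible_def by blast
qed

lemma multiview_in_G: "F \<in> G_ideal n"
  using multiview_expansion normal_sum_zero reduction_sum_in_G by simp

text \<open>For integral F each summand c (m - nf m) is in \<open>good\<close>, so its reduction is
  in L, and F is the sum of these.\<close>

lemma reduce_multiview_in_L:
  assumes "F \<in> integral_polys"
  shows "reduce F \<in> L_ideal n"
proof -
  have good: "single m 1 - nf m \<in> good n" if "m \<in> keys F" for m
  proof -
    have "reducible n m (nf m)" by (rule reducible_normal[OF keys_multiview[OF that]])
    then show ?thesis unfolding reducible_def by blast
  qed
  have "const (lookup F m) * (single m 1 - nf m) \<in> good n" if "m \<in> keys F" for m
    using assms by (intro good_mult good that integral_polys_const mpolys_const)
      (simp add: integral_polys_def)
  then have *: "const (lookup F m) * (single m 1 - nf m) \<in> integral_polys"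
    "reduce (const (lookup F m) * (single m 1 - nf m)) \<in> L_ideal n" if "m \<in> keys F" for m
    using that by (auto simp: good_def)
  have "F = (\<Sum>m\<in>keys F. const (lookup F m) * (single m 1 - nf m))"
    using multiview_expansion normal_sum_zero by simp
  then have "reduce F = reduce (\<Sum>m\<in>keys F. const (lookup F m) * (single m 1 - nf m))"
    by (rule arg_cong)
  also have "\<dots> = (\<Sum>m\<in>keys F. reduce (const (lookup F m) * (single m 1 - nf m)))"
    by (rule reduce_sum) (rule *)
  also have "\<dots> \<in> L_ideal n"
    by (rule ideal_sum[OF ideal_L]) (rule *)
  finally show ?thesis .
qed

text \<open>Compare the coefficient of b, the leading monomial, in the vanishing sum of normal forms
  at eps = 0. A term m contributes only if m <= b, by maximality of b, and b <= m, by the bound on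
  normal forms. If b were standard, the term m = b would leave the nonzero leading
  coefficient.\<close>

lemma lead_monom_not_standard:
  assumes int: "F \<in> integral_polys" and f: "reduce F \<noteq> 0"
  shows "\<not> standard n (lead_monom (reduce F))"
proof
  define b where "b = lead_monom (reduce F)"
  assume "standard n (lead_monom (reduce F))"
  then have std: "standard n b" by (simp add: b_def)
  have b: "b \<in> keys (reduce F)" "\<And>m. m \<in> keys (reduce F) \<Longrightarrow> m \<le> b"
    using f by (auto simp: b_def lead_monom_def intro!: Max_in)
  have bF: "b \<in> keys F" using b(1) by (auto simp: in_keys_iff lookup_reduce residue_consts)
  have red: "reducible n m (nf m)" if "m \<in> keys F" for m
    by (rule reducible_normal[OF keys_multiview[OF that]])
  have v: "lookup F m \<in> val_ring" "m \<in> keys F \<Longrightarrow> lookup (nf m) b \<in> val_ring" for m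
    using int red[of m] unfolding reducible_def integral_polys_def by blast+
  have "lookup (\<Sum>m\<in>keys F. const (lookup F m) * nf m) b =
      (\<Sum>m\<in>keys F. lookup F m * lookup (nf m) b)"
    by (simp add: lookup_sum lookup_const_mult)
  then have "(\<Sum>m\<in>keys F. lookup F m * lookup (nf m) b) = 0"
    unfolding normal_sum_zero by simp
  then have "0 = residue (\<Sum>m\<in>keys F. lookup F m * lookup (nf m) b)"
    by (simp add: residue_consts)
  also have "\<dots> = (\<Sum>m\<in>keys F. residue (lookup F m) * residue (lookup (nf m) b))"
    using v by (simp add: residue_sum val_ring_mult residue_mult)
  also have "\<dots> = (\<Sum>m\<in>keys F. if m = b then residue (lookup F b) else 0)"
  proof (rule sum.cong[OF refl])
    fix m assume m: "m \<in> keys F"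
    show "residue (lookup F m) * residue (lookup (nf m) b) =
        (if m = b then residue (lookup F b) else 0)"
    proof (cases "m = b")
      case True
      then have "nf m = single m 1" using red[OF m] std unfolding reducible_def by blast
      then show ?thesis using True by (simp add: residue_consts)
    next
      case False
      have "m \<le> b" if "residue (lookup F m) \<noteq> 0"
        using that b(2)[of m] by (simp add: in_keys_iff lookup_reduce)
      moreover have "b \<le> m" if "residue (lookup (nf m) b) \<noteq> 0"
        using that red[OF m] unfolding reducible_def by blast
      ultimately have "residue (lookup F m) = 0 \<or> residue (lookup (nf m) b) = 0"
        using False by (meson order_antisym)
      then show ?thesis using False by simp
    qed
  qed
  also have "\<dots> = residue (lookup F b)" using bF by simp
  finally show False using b(1) by (simp add: in_keys_iff lookup_reduce)
qed

end

lemma multiview_ideal_eq: "n \<ge> 1 \<Longrightarrow> G_ideal n = multiview_ideal n (camera n)"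
  using G_ideal_multiview multiview_in_G by blast

section \<open>The special fiber\<close>

lemma special_fiber_eq: "special_fiber I = reduce ` (I \<inter> integral_polys)"
  by (auto simp: special_fiber_def integral_polys_def)

lemma ideal_special_fiber:
  fixes I :: "'k::field poly fract mpoly set"
  assumes "ideal I (mpoly_ring n)"
  shows "ideal (special_fiber I) (mpoly_ring n)"
  unfolding ideal_mpoly_ring_iff special_fiber_eq
proof (intro conjI ballI)
  have "0 \<in> I" using assms by (simp add: ideal_mpoly_ring_iff)
  moreover have "reduce (0 :: 'k poly fract mpoly) = 0"
    by (rule poly_mapping_eqI) (simp add: lookup_reduce residue_consts)
  ultimately show "0 \<in> reduce ` (I \<inter> integral_polys)"
    by (auto simp: integral_polys_def val_ring_consts intro!: image_eqI[of _ _ 0])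
  show "reduce ` (I \<inter> integral_polys) \<subseteq> mpolys n"
    using ideal_subset[OF assms] mpolys_reduce by auto
next
  fix f g :: "'k mpoly"
  assume "f \<in> reduce ` (I \<inter> integral_polys)" "g \<in> reduce ` (I \<inter> integral_polys)"
  then obtain f' g' where *: "f' \<in> I" "f' \<in> integral_polys" "f = reduce f'"
    "g' \<in> I" "g' \<in> integral_polys" "g = reduce g'" by blast
  then have "f + g = reduce (f' + g')" by (simp add: reduce_add)
  then show "f + g \<in> reduce ` (I \<inter> integral_polys)"
    using * ideal_add[OF assms] integral_polys_add by blast
next
  fix f g :: "'k mpoly"
  assume "f \<in> reduce ` (I \<inter> integral_polys)" and g: "g \<in> mpolys n"
  then obtain f' where *: "f' \<in> I" "f' \<in> integral_polys" "f = reduce f'" by blast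
  \<comment> \<open>Multiplication by g is lifted by regarding its coefficients as constants in
    K(eps).\<close>
  define g' where "g' = Poly_Mapping.map scalar g"
  have l: "lookup g' m = scalar (lookup g m)" for m
    by (simp add: g'_def Poly_Mapping.map.rep_eq "when_def" scalar_simps)
  have "g' \<in> integral_polys" by (simp add: integral_polys_def l scalar_in_val_ring)
  moreover have "g' \<in> mpolys n" using g by (auto simp: mpolys_def in_keys_iff l scalar_simps)
  moreover have "reduce g' = g"
    by (rule poly_mapping_eqI) (simp add: lookup_reduce l residue_scalar)
  ultimately have "g * f = reduce (g' * f')" "g' * f' \<in> I \<inter> integral_polys"
    using * ideal_mult[OF assms] by (simp_all add: reduce_mult integral_polys_mult)
  then show "g * f \<in> reduce ` (I \<inter> integral_polys)" by blast
qed

text \<open>Each generator of L is the reduction of a quadric or of a normalised cubic in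
  \<open>good\<close>; the converse inclusion is \<open>reduce_multiview_in_L\<close>.\<close>

lemma L_ideal_special_fiber:
  assumes "n \<ge> 1"
  shows "(L_ideal n :: 'k::field mpoly set) = special_fiber (multiview_ideal n (camera n))"
proof
  have sub: "reduce f \<in> special_fiber (multiview_ideal n (camera n))" if "f \<in> good n"
    for f :: "'k poly fract mpoly"
    using that G_ideal_multiview unfolding good_def special_fiber_eq by blast
  show "(L_ideal n :: 'k mpoly set) \<subseteq> special_fiber (multiview_ideal n (camera n))"
    unfolding L_ideal_eq
  proof (rule genideal_least[OF ideal_special_fiber[OF ideal_multiview]], rule subsetI)
    fix f :: "'k mpoly" assume "f \<in> L_gens n"
    then show "f \<in> special_fiber (multiview_ideal n (camera n))"
    proof (cases rule: L_gens_cases)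
      case (1 i j)
      show ?thesis using sub[OF good_quadric[OF 1(1-3)]]
        by (simp add: 1(4) reduce_diff reduce_mult integral_intros reduce_indet)
    next
      case (2 i j k U V)
      note q = residue_eps_quotients[OF 2(2-4), where 'k = 'k]
      show ?thesis using sub[OF good_cubic[OF 2(1-5)]]
        by (simp add: 2(6) reduce_diff reduce_mult integral_intros q reduce_indet reduce_const const_simps)
    qed
  qed
next
  show "special_fiber (multiview_ideal n (camera n)) \<subseteq> (L_ideal n :: 'k mpoly set)"
    unfolding special_fiber_eq using reduce_multiview_in_L[OF assms] by blast
qed

subsection \<open>The initial ideal\<close>

definition N_gens :: "nat \<Rightarrow> 'k::field mpoly set" where
  "N_gens n = {indet (X i) * indet (Y j) | i j. 1 \<le> i \<and> i < j \<and> j \<le> n} \<union>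
      (\<Union>(i, j, k)\<in>{(i, j, k). 1 \<le> i \<and> i < j \<and> j < k \<and> k \<le> n}.
        {indet (X i) * indet (Z j) * indet (X k),
         indet (Y i) * indet (Z j) * indet (Y k),
         indet (Y i) * indet (Z j) * indet (X k)})"

lemma N_ideal_eq: "N_ideal n = genideal (mpoly_ring n) (N_gens n)"
  by (simp add: N_ideal_def N_gens_def)

lemma N_gens_cases:
  assumes "f \<in> N_gens n"
  obtains i j where "1 \<le> i" "i < j" "j \<le> n" "f = indet (X i) * indet (Y j)"
  | i j k U V where "1 \<le> i" "i < j" "j < k" "k \<le> n" "admissible U V"
    "f = indet (U i) * indet (Z j) * indet (V k)"
  using assms unfolding N_gens_def admissible_def by blast

lemma N_gens_mpolys: "N_gens n \<subseteq> mpolys n"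
proof
  fix f assume "f \<in> N_gens n"
  then show "f \<in> mpolys n"
    by (cases rule: N_gens_cases)
      (auto simp: unknowns_iff admissible_index intro!: mpolys_mult mpolys_indet)
qed

lemma nonstandard_in_N:
  assumes "keys m \<subseteq> unknowns n" "\<not> standard n m"
  shows "single m (1::'k::field) \<in> N_ideal n"
proof -
  have idl: "ideal (N_ideal n) (mpoly_ring n)"
    unfolding N_ideal_eq by (rule genideal_ideal[OF N_gens_mpolys])
  have in_n: "index v \<in> {1..n}" if "lookup m v > 0" for v
    using lookup_outside[OF assms(1), of v] that by auto
  have *: "single m (1::'k) \<in> N_ideal n"
    if "single d (1::'k) \<in> N_gens n" "\<And>v. lookup d v \<le> lookup m v" for d
  proof -
    obtain m0 where m: "m = m0 + d" using \<open>\<And>v. lookup d v \<le> lookup m v\<close> by (rule monomial_split)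
    have "single d (1::'k) \<in> N_ideal n"
      unfolding N_ideal_eq by (rule subsetD[OF genideal_superset that(1)])
    then have "single m0 1 * single d (1::'k) \<in> N_ideal n"
      using assms(1) by (intro ideal_mult[OF idl] mpolys_single) (simp_all add: m keys_monomial_add)
    then show ?thesis by (simp add: m mult_single)
  qed
  \<comment> \<open>The last condition of the second case excludes x_i together with y_k, so the
    cubic divisor can be chosen with an admissible pair.\<close>
  consider (quadric) i j where "i < j" "lookup m (X i) > 0" "lookup m (Y j) > 0"
    | (cubic) i j k where "i < j" "j < k" "xy m i > 0" "lookup m (Z j) > 0" "xy m k > 0"
      "lookup m (X i) = 0 \<or> lookup m (Y k) = 0"
  proof (cases "\<exists>i j. i < j \<and> lookup m (X i) > 0 \<and> lookup m (Y j) > 0")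
    case True
    then show thesis using that(1) by blast
  next
    case False
    then have sorted: "lookup m (X i) = 0 \<or> lookup m (Y j) = 0" if "i < j" for i j
      using that by auto
    then obtain i j k where "i < j" "j < k" "0 < xy m i" "0 < lookup m (Z j)" "0 < xy m k"
      using assms unfolding standard_def by blast
    then show thesis using that(2) sorted[of i k] less_trans by blast
  qed
  then show ?thesis
  proof cases
    case (quadric i j)
    have "1 \<le> i" "j \<le> n" using in_n[OF quadric(2)] in_n[OF quadric(3)] by simp_all
    then have "indet (X i) * indet (Y j) \<in> (N_gens n :: 'k mpoly set)"
      using quadric(1) unfolding N_gens_def by blast
    then show ?thesis
      unfolding indet_prod2 by (rule *) (use quadric in \<open>auto simp: lookup_add lookup_var\<close>)
  next
    case (cubic i j k)
    obtain U V where UV: "admissible U V" "0 < lookup m (U i)" "0 < lookup m (V k)"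
      using cubic(3,5,6) that[of X X] that[of Y X] that[of Y Y] by (auto simp: xy_def admissible_def)
    have "1 \<le> i" "k \<le> n"
      using in_n[OF UV(2)] in_n[OF UV(3)] admissible_index[OF UV(1)] by simp_all
    then have "indet (U i) * indet (Z j) * indet (V k) \<in> (N_gens n :: 'k mpoly set)"
      using cubic(1,2) UV(1) unfolding N_gens_def admissible_def by blast
    then show ?thesis
      unfolding indet_prod3
      by (rule *) (use cubic(1,2,4) UV in \<open>auto simp: lookup_add lookup_var admissible_def\<close>)
  qed
qed

lemma lead_monom_binomial:
  assumes "b < m"
  shows "lead_monom (single m 1 - single b (1::'a::field)) = m"
    and "single m 1 - single b (1::'a) \<noteq> 0"
proof -
  have "keys (single m 1 - single b (1::'a)) = {m, b}"
    using assms by (auto simp: in_keys_iff lookup_minus lookup_single "when_def" split: if_splits)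
  then show "lead_monom (single m 1 - single b (1::'a)) = m"
    "single m 1 - single b (1::'a) \<noteq> 0"
    using assms by (auto simp: lead_monom_def max_def)
qed

text \<open>An element of L lifts to an integral element of J, so its leading monomial is not
  standard and lies in N. Conversely, each generator of N is the leading monomial of a binomial
  generator of L.\<close>

lemma initial_ideal_L:
  assumes "n \<ge> 1"
  shows "initial_ideal n (L_ideal n) = (N_ideal n :: 'k::field mpoly set)"
proof
  have idl: "ideal (N_ideal n) (mpoly_ring n)"
    unfolding N_ideal_eq by (rule genideal_ideal[OF N_gens_mpolys])
  let ?S = "{single (lead_monom f) (1::'k) | f. f \<in> (L_ideal n :: 'k mpoly set) \<and> f \<noteq> 0}"
  have lead: "lead_monom f \<in> keys f" if "f \<noteq> 0" for f :: "'k mpoly"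
    using that by (simp add: lead_monom_def Max_in)
  show "initial_ideal n (L_ideal n) \<subseteq> (N_ideal n :: 'k mpoly set)"
    unfolding initial_ideal_def
  proof (rule genideal_least[OF idl], safe)
    fix f :: "'k mpoly" assume f: "f \<in> L_ideal n" "f \<noteq> 0"
    then have "f \<in> mpolys n" using ideal_subset[OF ideal_L] by blast
    then have "keys (lead_monom f) \<subseteq> unknowns n" using lead f(2) by (auto simp: mpolys_def)
    moreover obtain F where "F \<in> multiview_ideal n (camera n)" "F \<in> integral_polys" "f = reduce F"
      using f(1) unfolding L_ideal_special_fiber[OF assms] special_fiber_eq by blast
    then have "\<not> standard n (lead_monom f)"
      using lead_monom_not_standard[OF assms] f(2) by blast
    ultimately show "single (lead_monom f) (1::'k) \<in> N_ideal n" by (rule nonstandard_in_N)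
  qed
  have mp: "?S \<subseteq> mpolys n"
  proof safe
    fix f :: "'k mpoly" assume "f \<in> L_ideal n" "f \<noteq> 0"
    then show "single (lead_monom f) 1 \<in> mpolys n"
      using lead ideal_subset[OF ideal_L] by (intro mpolys_single) (force simp: mpolys_def)
  qed
  have inI: "single m (1::'k) \<in> initial_ideal n (L_ideal n)"
    if "single m 1 - single b (1::'k) \<in> L_gens n" "b < m" for m b
  proof -
    have "single m 1 - single b (1::'k) \<in> L_ideal n"
      unfolding L_ideal_eq by (rule subsetD[OF genideal_superset that(1)])
    then have "single m (1::'k) \<in> ?S" using lead_monom_binomial[OF that(2), where 'a = 'k] by force
    then show ?thesis unfolding initial_ideal_def by (rule subsetD[OF genideal_superset])
  qed
  show "(N_ideal n :: 'k mpoly set) \<subseteq> initial_ideal n (L_ideal n)"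
    unfolding N_ideal_eq
  proof (rule genideal_least, unfold initial_ideal_def, rule genideal_ideal[OF mp],
      fold initial_ideal_def, rule subsetI)
    fix f :: "'k mpoly" assume "f \<in> N_gens n"
    then show "f \<in> initial_ideal n (L_ideal n)"
    proof (cases rule: N_gens_cases)
      case (1 i j)
      have "indet (X i) * indet (Y j) - indet (X j) * indet (Y i) \<in> L_gens n"
        using 1 unfolding L_gens_def quadrics_def by blast
      moreover have "0 + (var (X j) + var (Y i)) < 0 + (var (X i) + var (Y j))"
        by (rule swap_lower) (use 1 in \<open>auto simp: less_unknown_def\<close>)
      ultimately show ?thesis unfolding 1(4) indet_prod2 by (intro inI) auto
    next
      case (2 i j k U V)
      have "var (V k) + (var (U j) + var (Z i)) < var (V k) + (var (U i) + var (Z j))"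
        by (rule swap_lower) (use 2 in \<open>auto simp: less_unknown_def admissible_def\<close>)
      then show ?thesis using L_gens_cubic[OF 2(1-5), where 'a = 'k]
        unfolding 2(6) indet_prod3 by (intro inI) (simp_all add: add_ac)
    qed
  qed
qed

theorem theorem5p1:
  fixes n :: nat
  assumes "n \<ge> 2"
  shows "genideal (mpoly_ring n) (G_set n) =
           multiview_ideal n (camera n :: nat \<Rightarrow> 'k::alg_closed_field poly fract ^ 4 ^ 3)
       \<and> (L_ideal n :: 'k mpoly set) = special_fiber (multiview_ideal n (camera n))
       \<and> initial_ideal n (L_ideal n :: 'k mpoly set) = N_ideal n"
proof -
  have "n \<ge> 1" using assms by simp
  then show ?thesis
    using multiview_ideal_eq L_ideal_special_fiber initial_ideal_L by blast
qed

end
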